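(* For every $k\in\mathbf N$, $$\tau\Big(\big((T^* )^kT^k\big)^2\Big)=\frac{2^{2k}}{(2k+1)!}.$$
   Context: $\mathbf N=\{1,2,\dots\}$. $T$ is the quasi-nilpotent $\mathrm{DT}(\delta_0,1)$-operator, and $\tau$ is the unique normalized trace on the von Neumann algebra generated by $T$. It is realized as the limit in $*$-moments of strictly upper triangular random matrices with i.i.d. complex Gaussian entries: for every word $p(T^*,T)$ in $T^*$ and $T$, $$\tau(p(T^*,T))=\lim_{d\to\infty}\mathbb E\Big[\tfrac1d\operatorname{Tr}\,p(T_d^*,T_d)\Big],$$ where $T_d$ is the random $d\times d$ matrix that is zero on and below the diagonal and whose entries strictly above the diagonal are i.i.d. complex Gaussian with mean $0$ and $\mathbb E|t|^2=1/d$ (real and imaginary parts independent, each of variance $1/(2d)$). *)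

theory Defs
  imports
    "HOL-Probability.Probability"
    "Jordan_Normal_Form.Schur_Decomposition"
begin

subsection \<open>Complex Hilbert spaces and bounded operators\<close>

(* The inner product is linear in its second argument. Completeness comes from banach. *)
class complex_hilbert = banach +
  fixes scaleC :: "complex \<Rightarrow> 'a \<Rightarrow> 'a"  (infixr \<open>*\<^sub>C\<close> 75)
    and cinner :: "'a \<Rightarrow> 'a \<Rightarrow> complex"
  assumes scaleC_add_right: "a *\<^sub>C (x + y) = a *\<^sub>C x + a *\<^sub>C y"
    and scaleC_add_left: "(a + b) *\<^sub>C x = a *\<^sub>C x + b *\<^sub>C x"
    and scaleC_scaleC: "a *\<^sub>C (b *\<^sub>C x) = (a * b) *\<^sub>C x"
    and scaleC_of_real: "complex_of_real r *\<^sub>C x = r *\<^sub>R x"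
    and cinner_commute: "cinner x y = cnj (cinner y x)"
    and cinner_add_right: "cinner x (y + z) = cinner x y + cinner x z"
    and cinner_scaleC_right: "cinner x (a *\<^sub>C y) = a * cinner x y"
    and cinner_self: "cinner x x = complex_of_real ((norm x)\<^sup>2)"

definition bounded_op :: "('h::complex_hilbert \<Rightarrow> 'h) \<Rightarrow> bool" where
  "bounded_op A \<longleftrightarrow> bounded_linear A \<and> (\<forall>c x. A (c *\<^sub>C x) = c *\<^sub>C A x)"

definition op_adjoint :: "('h::complex_hilbert \<Rightarrow> 'h) \<Rightarrow> 'h \<Rightarrow> 'h" where
  "op_adjoint A = (THE B. \<forall>x y. cinner (B x) y = cinner x (A y))"

definition commutant :: "('h::complex_hilbert \<Rightarrow> 'h) set \<Rightarrow> ('h \<Rightarrow> 'h) set" where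
  "commutant S = {A. bounded_op A \<and> (\<forall>B\<in>S. A \<circ> B = B \<circ> A)}"

definition vN_generated :: "('h::complex_hilbert \<Rightarrow> 'h) \<Rightarrow> ('h \<Rightarrow> 'h) set" where
  "vN_generated T = commutant (commutant {T, op_adjoint T})"

(* A faithful normal tracial state on the von Neumann algebra M. Normality is expressed as
   membership in the predual, i.e. ultraweak continuity. Values of tau outside M are irrelevant. *)
definition normalized_trace :: "('h::complex_hilbert \<Rightarrow> 'h) set \<Rightarrow> (('h \<Rightarrow> 'h) \<Rightarrow> complex) \<Rightarrow> bool" where
  "normalized_trace M \<tau> \<longleftrightarrow>
     (\<forall>A\<in>M. \<forall>B\<in>M. \<tau> (\<lambda>x. A x + B x) = \<tau> A + \<tau> B) \<and>
     (\<forall>c. \<forall>A\<in>M. \<tau> (\<lambda>x. c *\<^sub>C A x) = c * \<tau> A) \<and>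
     \<tau> id = 1 \<and>
     (\<forall>A\<in>M. \<tau> (op_adjoint A \<circ> A) \<in> \<real>\<^sub>\<ge>\<^sub>0) \<and>
     (\<forall>A\<in>M. \<forall>B\<in>M. \<tau> (A \<circ> B) = \<tau> (B \<circ> A)) \<and>
     (\<forall>A\<in>M. \<tau> (op_adjoint A \<circ> A) = 0 \<longrightarrow> A = (\<lambda>x. 0)) \<and>
     (\<exists>\<xi> \<eta> :: nat \<Rightarrow> 'h. summable (\<lambda>n. (norm (\<xi> n))\<^sup>2) \<and> summable (\<lambda>n. (norm (\<eta> n))\<^sup>2) \<and>
        (\<forall>A\<in>M. (\<lambda>n. cinner (\<eta> n) (A (\<xi> n))) sums \<tau> A))"

subsection \<open>Words in an operator or matrix and its adjoint\<close>

datatype letter = Plain | Star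

primrec op_word :: "('h::complex_hilbert \<Rightarrow> 'h) \<Rightarrow> letter list \<Rightarrow> 'h \<Rightarrow> 'h" where
  "op_word T [] = id"
| "op_word T (l # w) = (case l of Plain \<Rightarrow> T | Star \<Rightarrow> op_adjoint T) \<circ> op_word T w"

primrec mat_word :: "nat \<Rightarrow> complex mat \<Rightarrow> letter list \<Rightarrow> complex mat" where
  "mat_word d A [] = 1\<^sub>m d"
| "mat_word d A (l # w) = (case l of Plain \<Rightarrow> A | Star \<Rightarrow> mat_adjoint A) * mat_word d A w"

subsection \<open>Strictly upper triangular complex Gaussian random matrices\<close>

(* The law of a centred complex Gaussian t with E |t|^2 = v: real and imaginary part are
   independent real Gaussians of variance v / 2. The second argument of normal_density is the
   standard deviation. *)
definition complex_gaussian :: "real \<Rightarrow> complex measure" where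
  "complex_gaussian v =
     (let N = density lborel (\<lambda>x. ennreal (normal_density 0 (sqrt (v / 2)) x))
      in distr (N \<Otimes>\<^sub>M N) borel (\<lambda>(x, y). Complex x y))"

(* The joint law of the independent entries above the diagonal. *)
definition upper_entries :: "nat \<Rightarrow> (nat \<times> nat \<Rightarrow> complex) measure" where
  "upper_entries d = (\<Pi>\<^sub>M ij\<in>{(i, j). i < j \<and> j < d}. complex_gaussian (1 / real d))"

definition upper_mat :: "nat \<Rightarrow> (nat \<times> nat \<Rightarrow> complex) \<Rightarrow> complex mat" where
  "upper_mat d \<omega> = Matrix.mat d d (\<lambda>(i, j). if i < j then \<omega> (i, j) else 0)"

definition mat_trace :: "complex mat \<Rightarrow> complex" where
  "mat_trace A = (\<Sum>i<dim_row A. A $$ (i, i))"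

definition matrix_moment :: "nat \<Rightarrow> letter list \<Rightarrow> complex" where
  "matrix_moment d w =
     (LINT \<omega>|upper_entries d. 1 / of_nat d * mat_trace (mat_word d (upper_mat d \<omega>) w))"

subsection \<open>The quasi-nilpotent DT operator\<close>

definition DT_delta0_1 :: "('h::complex_hilbert \<Rightarrow> 'h) \<Rightarrow> (('h \<Rightarrow> 'h) \<Rightarrow> complex) \<Rightarrow> bool" where
  "DT_delta0_1 T \<tau> \<longleftrightarrow>
     bounded_op T \<and>
     normalized_trace (vN_generated T) \<tau> \<and>
     (\<forall>w. (\<lambda>d. matrix_moment d w) \<longlonglongrightarrow> \<tau> (op_word T w))"

end

theory Submission
  imports Defs "HOL-Real_Asymp.Real_Asymp"
begin

text \<open>
  The trace of a word is a limit of moments of random matrices, so the claim is about the limit of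
  E (1/d) Tr (A* A A* A), where A is the k-th power of the random d x d matrix. As that matrix
  is strictly upper triangular, the entry (i, j) of A is a sum over increasing paths from i to j
  with k steps. Such a path is just a (k+1)-subset of {..<d} with minimum i and maximum j, and the
  trace becomes a sum over quadruples (P, Q, R, S) of these sets with matching end points, P and R
  belonging to the conjugated factors.

  The entries are independent and E (t^n (cnj t)^m) = 0 unless n = m, since the law
  of t is invariant under rotation. Hence a quadruple contributes only if it is balanced, that is,
  if P and R together use each step as often as Q and S together do; it then contributes d^(-2k)
  times a product of factorials (\<open>matrix_moment_quads\<close>). With the factor 1/d of the trace, only
  families of d^(2k+1) quadruples matter in the limit.

  In a balanced quadruple Q starts on P, ends on R, and uses only steps of P and R, so it can
  change from P to R only at a common vertex. Therefore P and R meet. If they meet in exactly one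
  vertex v, then Q must follow P up to v and R afterwards, S does the opposite, and v has the same
  rank j in P and R (\<open>balanced_single_crossing\<close>). Counting these configurations amounts to choosing
  the 2k+1 vertices and distributing the 2j below v and the 2(k-j) above v evenly between P and R,
  which gives (d choose 2k+1) times \<Sum>j\<le>k. (2j choose j) (2(k-j) choose k-j) = 4^k
  (\<open>card_crossing_pairs\<close>). If P and R meet more than once, only 2k vertices remain, and there are
  O(d^(2k)) such quadruples (\<open>card_degenerate_quads\<close>). As (d choose 2k+1) / d^(2k+1) tends to
  1/(2k+1)!, the limit is 4^k / (2k+1)!. The values j = 0, ..., k correspond to the k+1 non-crossing
  pairings of the word.
\<close>

section \<open>Binomial sums\<close>

text \<open>An (a+b+1)-subset of {..<d} is determined by its element v of rank a, the a elements
  below v and the b elements above it.\<close>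
lemma sum_choose_mult_choose: "(\<Sum>v<d. (v choose a) * ((d - 1 - v) choose b)) = d choose (a + b + 1)"
proof (induction d arbitrary: b)
  case (Suc d)
  show ?case
  proof (cases b)
    case 0
    then show ?thesis using sum_choose_upper[of a d] by (simp add: lessThan_Suc_atMost)
  next
    case (Suc c)
    have "(\<Sum>v<Suc d. (v choose a) * ((Suc d - 1 - v) choose b)) = (\<Sum>v<d. (v choose a) * ((d - v) choose b))"
      using Suc by simp
    also have "\<dots> = (\<Sum>v<d. (v choose a) * ((d - 1 - v) choose c) + (v choose a) * ((d - 1 - v) choose b))"
    proof (rule sum.cong)
      fix v assume "v \<in> {..<d}"
      then have "d - v = Suc (d - 1 - v)" by auto
      then show "(v choose a) * ((d - v) choose b) = (v choose a) * ((d - 1 - v) choose c) + (v choose a) * ((d - 1 - v) choose b)"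
        using Suc by (simp add: algebra_simps)
    qed simp
    also have "\<dots> = Suc d choose (a + b + 1)"
      using Suc.IH[of b] Suc.IH[of c] Suc by (simp add: sum.distrib)
    finally show ?thesis .
  qed
qed simp

text \<open>The coefficient form of (1 - 4x)^(-1/2) = \<Sum> (2j choose j) x^j.\<close>
lemma central_binomial_gbinomial: "real ((2 * j) choose j) = (-4) ^ j * ((- 1 / 2) gchoose j)"
proof (induction j)
  case (Suc j)
  have "Suc j * (Suc (Suc (2 * j)) choose Suc j) = Suc (Suc (2 * j)) * (Suc (2 * j) choose j)"
    by (rule Suc_times_binomial)
  also have "Suc (2 * j) choose j = Suc (2 * j) choose Suc j"
    using binomial_symmetric[of j "Suc (2 * j)"] by simp
  also have "Suc (Suc (2 * j)) * (Suc (2 * j) choose Suc j) = 2 * (Suc j * (Suc (2 * j) choose Suc j))"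
    by simp
  also have "Suc j * (Suc (2 * j) choose Suc j) = Suc (2 * j) * (2 * j choose j)"
    by (rule Suc_times_binomial)
  finally have "real (Suc j * (Suc (Suc (2 * j)) choose Suc j)) = real (2 * (Suc (2 * j) * (2 * j choose j)))"
    by (simp only:)
  then have "real (Suc j) * real (2 * Suc j choose Suc j) = 2 * real (Suc (2 * j)) * real (2 * j choose j)"
    by (simp only: of_nat_mult mult.assoc of_nat_numeral mult_Suc_right add_2_eq_Suc)
  also have "\<dots> = (- 4) ^ Suc j * ((- 1 / 2 - real j) * ((- 1 / 2) gchoose j))"
    unfolding Suc.IH by (simp add: field_simps)
  also have "(- 1 / 2 - real j) * ((- 1 / 2) gchoose j) = real (Suc j) * ((- 1 / 2) gchoose Suc j)"
    using gbinomial_mult_1[of "-1/2::real" j] by (simp only: left_diff_distrib)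
  finally have "real (Suc j) * real (2 * Suc j choose Suc j) = real (Suc j) * ((-4) ^ Suc j * ((- 1 / 2) gchoose Suc j))"
    by (simp only: mult_ac)
  then show ?case by (subst (asm) mult_left_cancel) (simp_all del: of_nat_Suc)
qed simp

text \<open>Squaring (1 - 4x)^(-1/2) gives (1 - 4x)^(-1); on coefficients this is the Vandermonde
  identity at -1/2 - 1/2 = -1.\<close>
lemma sum_central_binomials: "(\<Sum>j\<le>k. ((2 * j) choose j) * ((2 * (k - j)) choose (k - j))) = (4::nat) ^ k"
proof -
  have "real (\<Sum>j\<le>k. ((2 * j) choose j) * ((2 * (k - j)) choose (k - j)))
      = (\<Sum>j\<le>k. (-4) ^ k * (((- 1 / 2) gchoose j) * ((- 1 / 2) gchoose (k - j))))"
    unfolding of_nat_sum of_nat_mult central_binomial_gbinomial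
  proof (rule sum.cong)
    fix j assume "j \<in> {..k}"
    then have "(-4::real) ^ k = (-4) ^ j * (-4) ^ (k - j)" by (simp flip: power_add)
    then show "(- 4) ^ j * (- 1 / 2 gchoose j) * ((- 4) ^ (k - j) * (- 1 / 2 gchoose (k - j))) =
         (- 4 :: real) ^ k * ((- 1 / 2 gchoose j) * (- 1 / 2 gchoose (k - j)))" by simp
  qed simp
  also have "\<dots> = (-4) ^ k * ((-1) gchoose k)"
    using gbinomial_Vandermonde[where a = "-1/2::real" and b = "-1/2" and n = k] by (simp add: atMost_atLeast0 flip: sum_distrib_left)
  also have "((-1::real) gchoose k) = (-1) ^ k"
    using gbinomial_minus[of "1::real" k] by (simp add: gbinomial_1 flip: binomial_gbinomial)
  also have "(-4::real) ^ k * (-1) ^ k = 4 ^ k"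
    by (simp flip: power_mult_distrib)
  finally show ?thesis by (metis of_nat_eq_iff of_nat_numeral of_nat_power)
qed

lemma binomial_over_power_tendsto: "(\<lambda>d. real (d choose n) / real d ^ n) \<longlonglongrightarrow> 1 / fact n"
proof -
  have "(\<lambda>d. (\<Prod>i<n. (real d - real i) / real d) / fact n) \<longlonglongrightarrow> (\<Prod>i<n. 1) / fact n"
    by (intro tendsto_divide tendsto_prod tendsto_const) (real_asymp | simp)+
  moreover have "(\<Prod>i<n. (real d - real i) / real d) / fact n = real (d choose n) / real d ^ n" for d
    unfolding binomial_gbinomial gbinomial_prod_rev
    by (simp add: prod_dividef atLeast0LessThan)
  ultimately show ?thesis by simp
qed

section \<open>Increasing paths as finite sets\<close>

text \<open>An increasing path is encoded by the finite set of vertices it visits; its steps join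
  consecutive elements of that set.\<close>
definition steps :: "nat set \<Rightarrow> (nat \<times> nat) set" where
  "steps S = {(i, j). i \<in> S \<and> j \<in> S \<and> i < j \<and> S \<inter> {i<..<j} = {}}"

lemma steps_subset: "S \<subseteq> {..<d} \<Longrightarrow> steps S \<subseteq> {(i, j). i < j \<and> j < d}"
  by (auto simp: steps_def)

lemma finite_steps: "finite S \<Longrightarrow> finite (steps S)"
  by (rule finite_subset[of _ "S \<times> S"]) (auto simp: steps_def)

lemma step_into:
  assumes "finite Q" "x \<in> Q" "x \<noteq> Min Q"
  obtains y where "(y, x) \<in> steps Q"
proof -
  define y where "y = Max (Q \<inter> {..<x})"
  have "Min Q \<in> Q \<inter> {..<x}"
    using assms by (metis Int_iff Min_in Min_le empty_iff lessThan_iff order_le_neq_trans)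
  then have "y \<in> Q \<inter> {..<x}" "\<And>z. z \<in> Q \<inter> {..<x} \<Longrightarrow> z \<le> y"
    unfolding y_def using assms by (auto intro!: Max_in simp del: Int_iff)
  then have "(y, x) \<in> steps Q"
    using assms by (force simp: steps_def)
  then show thesis by (rule that)
qed

lemma step_out_of:
  assumes "finite Q" "x \<in> Q" "x \<noteq> Max Q"
  obtains y where "(x, y) \<in> steps Q"
proof -
  define y where "y = Min (Q \<inter> {x<..})"
  have "Max Q \<in> Q \<inter> {x<..}"
    using assms by (metis Int_iff Max_in Max_ge empty_iff greaterThan_iff order_le_neq_trans)
  then have "y \<in> Q \<inter> {x<..}" "\<And>z. z \<in> Q \<inter> {x<..} \<Longrightarrow> y \<le> z"
    unfolding y_def using assms by (auto intro!: Min_in simp del: Int_iff)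
  then have "(x, y) \<in> steps Q"
    using assms by (force simp: steps_def)
  then show thesis by (rule that)
qed

text \<open>A step is determined by its lower end, which can be any vertex but the last.\<close>
lemma card_steps:
  assumes "finite S" "S \<noteq> {}" shows "card (steps S) = card S - 1"
proof -
  have "inj_on fst (steps S)"
  proof (rule inj_onI, clarsimp simp: steps_def)
    fix i j j' assume "S \<inter> {i<..<j} = {}" "S \<inter> {i<..<j'} = {}" "i < j" "i < j'" "j \<in> S" "j' \<in> S"
    then show "j = j'" by (cases j j' rule: linorder_cases) auto
  qed
  then have "card (steps S) = card (fst ` steps S)" by (simp add: card_image)
  also have "fst ` steps S = S - {Max S}"
  proof (intro equalityI subsetI)
    fix x assume "x \<in> fst ` steps S"
    then obtain y where "x \<in> S" "y \<in> S" "x < y" by (auto simp: steps_def)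
    with Max_ge[OF assms(1), of y] show "x \<in> S - {Max S}" by auto
  next
    fix x assume "x \<in> S - {Max S}"
    then obtain y where "(x, y) \<in> steps S" using step_out_of[OF assms(1), of x] by blast
    then show "x \<in> fst ` steps S" by force
  qed
  finally show ?thesis using assms by simp
qed

text \<open>A path Q that starts on P and uses only steps of P and R cannot leave P before it
  reaches a common vertex of P and R: a step of R out of a vertex of P starts at a common vertex.\<close>
lemma follow_from_Min:
  assumes fin: "finite Q" and sub: "steps Q \<subseteq> steps P \<union> steps R" and start: "Min Q \<in> P"
  shows "x \<in> Q \<Longrightarrow> (\<And>z. z \<in> P \<inter> R \<Longrightarrow> x \<le> z) \<Longrightarrow> x \<in> P"
proof (induction x rule: less_induct)
  case (less x)
  show ?case
  proof (cases "x = Min Q")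
    case False
    then obtain y where y: "(y, x) \<in> steps Q" using step_into fin less.prems(1) by blast
    then consider "(y, x) \<in> steps P" | "(y, x) \<in> steps R" using sub by blast
    then show ?thesis
    proof cases
      case 2
      have "y \<in> P" using less.IH[of y] y less.prems(2) by (force simp: steps_def)
      with 2 less.prems(2)[of y] show ?thesis by (auto simp: steps_def)
    qed (auto simp: steps_def)
  qed (use start in simp)
qed

text \<open>The mirror image: after the last common vertex of P and R, a path that ends on R
  already runs on R.\<close>
lemma follow_to_Max:
  assumes fin: "finite Q" and sub: "steps Q \<subseteq> steps P \<union> steps R" and last: "Max Q \<in> R"
  shows "x \<in> Q \<Longrightarrow> (\<And>z. z \<in> P \<inter> R \<Longrightarrow> z \<le> x) \<Longrightarrow> x \<in> R"
proof (induction "Max Q - x" arbitrary: x rule: less_induct)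
  case less
  show ?case
  proof (cases "x = Max Q")
    case False
    then obtain y where y: "(x, y) \<in> steps Q" using step_out_of fin less.prems(1) by blast
    then have "y \<le> Max Q" "x < y" "y \<in> Q" using fin by (auto simp: steps_def)
    consider "(x, y) \<in> steps P" | "(x, y) \<in> steps R" using sub y by blast
    then show ?thesis
    proof cases
      case 1
      have "y \<in> R" 
        using less.hyps[of y] \<open>y \<le> Max Q\<close> \<open>x < y\<close> \<open>y \<in> Q\<close> less.prems(2) by force
      with 1 \<open>x < y\<close> less.prems(2)[of y] show ?thesis by (auto simp: steps_def)
    qed (auto simp: steps_def)
  qed (use last in simp)
qed

section \<open>Balanced quadruples of paths\<close>

text \<open>The exponent of an entry (or of its conjugate) in the monomial belonging to two paths.\<close>
definition step_mult :: "nat set \<Rightarrow> nat set \<Rightarrow> nat \<times> nat \<Rightarrow> nat" where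
  "step_mult P R e = of_bool (e \<in> steps P) + of_bool (e \<in> steps R)"

text \<open>The index set of the trace of A* A A* A, where A is the k-th power of a strictly upper
  triangular matrix. P and R index the two conjugated factors, Q and S the two plain ones, and
  the four equations say that adjacent factors share a matrix index.\<close>
definition quads :: "nat \<Rightarrow> nat \<Rightarrow> (nat set \<times> nat set \<times> nat set \<times> nat set) set" where
  "quads d k = {(P, Q, R, S). (\<forall>X\<in>{P, Q, R, S}. X \<subseteq> {..<d} \<and> card X = Suc k) \<and>
     Min P = Min Q \<and> Max Q = Max R \<and> Min R = Min S \<and> Max S = Max P}"

text \<open>By independence and rotation invariance of the entries, only these quadruples have nonzero
  expectation: every entry must occur as often as its conjugate.\<close>
definition balanced_quads :: "nat \<Rightarrow> nat \<Rightarrow> (nat set \<times> nat set \<times> nat set \<times> nat set) set" where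
  "balanced_quads d k = {(P, Q, R, S) \<in> quads d k. step_mult P R = step_mult Q S}"

lemma quadsD:
  assumes "(P, Q, R, S) \<in> quads d k"
  shows "X \<in> {P, Q, R, S} \<Longrightarrow> finite X" "X \<in> {P, Q, R, S} \<Longrightarrow> X \<subseteq> {..<d}" 
    "X \<in> {P, Q, R, S} \<Longrightarrow> X \<noteq> {}" "X \<in> {P, Q, R, S} \<Longrightarrow> card X = Suc k"
    "Min Q \<in> P" "Max Q \<in> R" "Min S \<in> R" "Max S \<in> P"
proof -
  show fin: "finite X" if "X \<in> {P, Q, R, S}" for X
    using that assms finite_subset[of _ "{..<d}"] unfolding quads_def by blast
  show ne: "X \<noteq> {}" if "X \<in> {P, Q, R, S}" for X
    using that assms unfolding quads_def by force
  show "X \<subseteq> {..<d}" "card X = Suc k" if "X \<in> {P, Q, R, S}"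
    using that assms unfolding quads_def by auto
  have eq: "Min P = Min Q \<and> Max Q = Max R \<and> Min R = Min S \<and> Max S = Max P"
    using assms by (simp add: quads_def)
  show "Min Q \<in> P" "Max Q \<in> R" "Min S \<in> R" "Max S \<in> P"
    using eq fin[of P] fin[of R] ne[of P] ne[of R] by (metis Min_in Max_in insertCI)+
qed

lemma finite_quads: "finite (quads d k)"
  by (rule finite_subset[of _ "Pow {..<d} \<times> Pow {..<d} \<times> Pow {..<d} \<times> Pow {..<d}"]) (auto simp: quads_def)

lemma finite_balanced_quads: "finite (balanced_quads d k)"
  by (rule finite_subset[OF _ finite_quads[of d k]]) (auto simp: balanced_quads_def)

lemma step_mult_eq_imp_steps_subset:
  assumes "step_mult P R = step_mult Q S" shows "steps Q \<subseteq> steps P \<union> steps R" "steps S \<subseteq> steps P \<union> steps R"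
proof -
  have "e \<in> steps P \<union> steps R" if "e \<in> steps Q \<union> steps S" for e
    using fun_cong[OF assms, of e] that by (auto simp: step_mult_def of_bool_def split: if_splits)
  then show "steps Q \<subseteq> steps P \<union> steps R" "steps S \<subseteq> steps P \<union> steps R" by auto
qed

lemma balanced_subset_union:
  assumes "(P, Q, R, S) \<in> balanced_quads d k"
  shows "Q \<subseteq> P \<union> R" "S \<subseteq> P \<union> R"
proof -
  have q: "(P, Q, R, S) \<in> quads d k" and m: "step_mult P R = step_mult Q S"
    using assms by (auto simp: balanced_quads_def)
  have *: "X \<subseteq> P \<union> R" if X: "finite X" "Min X \<in> P \<union> R" "steps X \<subseteq> steps P \<union> steps R" for X
  proof
    fix x assume "x \<in> X"
    show "x \<in> P \<union> R"
    proof (cases "x = Min X")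
      case False
      then obtain y where "(y, x) \<in> steps X" using step_into[OF X(1) \<open>x \<in> X\<close>] by blast
      then have "(y, x) \<in> steps P \<union> steps R" using X(3) by blast
      then show ?thesis by (auto simp: steps_def)
    qed (use X in simp)
  qed
  show "Q \<subseteq> P \<union> R" "S \<subseteq> P \<union> R"
    using quadsD[OF q] by (intro *[OF _ _ step_mult_eq_imp_steps_subset(1)[OF m]] *[OF _ _ step_mult_eq_imp_steps_subset(2)[OF m]]; simp)+
qed

text \<open>If P and R were disjoint, Q would have to stay on P from its start on P and also to stay on R
  until its end on R.\<close>
lemma balanced_meet:
  assumes "(P, Q, R, S) \<in> balanced_quads d k"
  shows "P \<inter> R \<noteq> {}"
proof
  assume disj: "P \<inter> R = {}"
  have q: "(P, Q, R, S) \<in> quads d k" and m: "step_mult P R = step_mult Q S"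
    using assms by (auto simp: balanced_quads_def)
  note D = quadsD[OF q]
  have "Q \<noteq> {}" using D(3) by simp
  then obtain x where "x \<in> Q" by auto
  then have "x \<in> P" "x \<in> R"
    using follow_from_Min[OF _ step_mult_eq_imp_steps_subset(1)[OF m] D(5), of x]
      follow_to_Max[OF _ step_mult_eq_imp_steps_subset(1)[OF m] D(6), of x] D(1)[of Q] disj by auto
  with disj show False by auto
qed

definition crossover :: "nat \<Rightarrow> nat set \<Rightarrow> nat set \<Rightarrow> nat set" where
  "crossover v P R = (P \<inter> {..v}) \<union> (R \<inter> {v..})"

lemma card_split_at:
  fixes X :: "nat set"
  assumes "finite X" "v \<in> X"
  shows "card X = card (X \<inter> {..<v}) + card (X \<inter> {v..})"
    and "card (X \<inter> {v..}) = Suc (card (X \<inter> {v<..}))"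
proof -
  have "card ((X \<inter> {..<v}) \<union> (X \<inter> {v..})) = card (X \<inter> {..<v}) + card (X \<inter> {v..})"
    using assms by (intro card_Un_disjoint) auto
  moreover have "(X \<inter> {..<v}) \<union> (X \<inter> {v..}) = X" by auto
  ultimately show "card X = card (X \<inter> {..<v}) + card (X \<inter> {v..})" by simp
  have "X \<inter> {v..} = insert v (X \<inter> {v<..})" using assms by auto
  then show "card (X \<inter> {v..}) = Suc (card (X \<inter> {v<..}))" using assms by auto
qed

lemma card_crossover:
  assumes "finite P" "finite R" "v \<in> P" "v \<in> R"
  shows "card (crossover v P R) = card (P \<inter> {..<v}) + card (R \<inter> {v..})"
proof -
  have "crossover v P R = (P \<inter> {..<v}) \<union> (R \<inter> {v..})"
    using assms by (auto simp: crossover_def order.order_iff_strict)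
  then show ?thesis using assms by (simp add: card_Un_disjoint disjoint_iff)
qed

text \<open>With a single common vertex v, the two follow lemmas leave Q and S no choice but to
  change over at v. They confine Q and S to the two crossovers, whose sizes add up to those of P
  and R, hence to those of Q and S, so both inclusions are equalities. Comparing the size of a
  crossover with that of P then forces v to have the same rank in P and in R.\<close>
lemma balanced_single_crossing:
  assumes "(P, Q, R, S) \<in> balanced_quads d k" and v: "P \<inter> R = {v}"
  shows "Q = crossover v P R" "S = crossover v R P" "card (P \<inter> {..<v}) = card (R \<inter> {..<v})"
proof -
  have q: "(P, Q, R, S) \<in> quads d k" and m: "step_mult P R = step_mult Q S"
    using assms by (auto simp: balanced_quads_def)
  note D = quadsD[OF q]
  have fin: "finite P" "finite Q" "finite R" "finite S" and vin: "v \<in> P" "v \<in> R" using D(1) v by auto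
  have cards: "card P = Suc k" "card Q = Suc k" "card R = Suc k" "card S = Suc k" using D(4) by auto
  have subQ: "Q \<subseteq> crossover v P R"
  proof
    fix x assume "x \<in> Q"
    then show "x \<in> crossover v P R"
      using follow_from_Min[OF fin(2) step_mult_eq_imp_steps_subset(1)[OF m] D(5), of x]
        follow_to_Max[OF fin(2) step_mult_eq_imp_steps_subset(1)[OF m] D(6), of x] v
      by (cases x v rule: linorder_cases) (auto simp: crossover_def)
  qed
  have sS: "steps S \<subseteq> steps R \<union> steps P"
    using step_mult_eq_imp_steps_subset(2)[OF m] by blast
  have v': "R \<inter> P = {v}" using v by blast
  have subS: "S \<subseteq> crossover v R P"
  proof
    fix x assume "x \<in> S"
    then show "x \<in> crossover v R P"
      using follow_from_Min[OF fin(4) sS D(7), of x]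
        follow_to_Max[OF fin(4) sS D(8), of x] v'
      by (cases x v rule: linorder_cases) (auto simp: crossover_def)
  qed
  have finsp: "finite (crossover v P R)" "finite (crossover v R P)" using fin by (auto simp: crossover_def)
  have c: "card (crossover v P R) = card (P \<inter> {..<v}) + card (R \<inter> {v..})"
     "card (crossover v R P) = card (R \<inter> {..<v}) + card (P \<inter> {v..})"
    using card_crossover fin vin by auto
  have "card Q \<le> card (crossover v P R)" "card S \<le> card (crossover v R P)"
    using subQ subS finsp by (auto intro: card_mono)
  with c cards card_split_at(1)[OF fin(1) vin(1)] card_split_at(1)[OF fin(3) vin(2)]
  have e: "card (crossover v P R) = Suc k" "card (crossover v R P) = Suc k" by linarith+
  show "Q = crossover v P R" "S = crossover v R P"
    using card_subset_eq[OF finsp(1) subQ] card_subset_eq[OF finsp(2) subS] e cards by auto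
  show "card (P \<inter> {..<v}) = card (R \<inter> {..<v})"
    using e c cards card_split_at(1)[OF fin(1) vin(1)] card_split_at(1)[OF fin(3) vin(2)] by linarith
qed

lemma steps_crossover:
  assumes "v \<in> P" "v \<in> R"
  shows "e \<in> steps (crossover v P R) \<longleftrightarrow> e \<in> steps (P \<inter> {..v}) \<or> e \<in> steps (R \<inter> {v..})"
proof (cases e)
  case (Pair i j)
  have "v \<in> crossover v P R" using assms by (auto simp: crossover_def)
  show ?thesis
  proof (cases "i < v \<and> v < j")
    case True
    then show ?thesis using Pair \<open>v \<in> crossover v P R\<close> by (auto simp: steps_def)
  next
    case False
    then show ?thesis using Pair assms by (fastforce simp: steps_def crossover_def)
  qed
qed

lemma steps_meet_at_one: "P \<inter> R \<subseteq> {v} \<Longrightarrow> steps P \<inter> steps R = {}"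
  unfolding steps_def by blast

lemma step_mult_le_1: "P \<inter> R \<subseteq> {v} \<Longrightarrow> step_mult P R e \<le> 1"
  using steps_meet_at_one[of P R v] by (auto simp: step_mult_def)

text \<open>Crossing over at v only redistributes the steps below and above v between the two
  paths.\<close>
lemma step_mult_crossover:
  assumes v: "P \<inter> R = {v}"
  shows "step_mult P R = step_mult (crossover v P R) (crossover v R P)"
proof
  fix e
  have vin: "v \<in> P" "v \<in> R" using v by auto
  have self: "crossover v X X = X" for X by (auto simp: crossover_def)
  have *: "of_bool (e \<in> steps (crossover v X Y)) = of_bool (e \<in> steps (X \<inter> {..v})) + (of_bool (e \<in> steps (Y \<inter> {v..})) :: nat)"
    if "v \<in> X" "v \<in> Y" for X Y
  proof -
    have "steps (X \<inter> {..v}) \<inter> steps (Y \<inter> {v..}) = {}"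
      by (rule steps_meet_at_one[of _ _ v]) auto
    then show ?thesis using steps_crossover[OF that, of e] by auto
  qed
  show "step_mult P R e = step_mult (crossover v P R) (crossover v R P) e"
    unfolding step_mult_def *[OF vin] *[OF vin(2,1)]
    using *[OF vin(1,1)] *[OF vin(2,2)] unfolding self by simp
qed

lemma Min_crossover:
  assumes "finite P" "finite R" "v \<in> P" shows "Min (crossover v P R) = Min P"
proof (rule Min_eqI)
  have "P \<noteq> {}" using assms by auto
  then have "Min P \<in> P" "Min P \<le> v" "\<And>x. x \<in> P \<Longrightarrow> Min P \<le> x" using assms by auto
  then show "Min P \<in> crossover v P R" "\<And>y. y \<in> crossover v P R \<Longrightarrow> Min P \<le> y"
    by (auto simp: crossover_def intro: order_trans)
qed (use assms in \<open>auto simp: crossover_def\<close>)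

lemma Max_crossover:
  assumes "finite P" "finite R" "v \<in> R" shows "Max (crossover v P R) = Max R"
proof (rule Max_eqI)
  have "R \<noteq> {}" using assms by auto
  then have "Max R \<in> R" "v \<le> Max R" "\<And>x. x \<in> R \<Longrightarrow> x \<le> Max R" using assms by auto
  then show "Max R \<in> crossover v P R" "\<And>y. y \<in> crossover v P R \<Longrightarrow> y \<le> Max R"
    by (auto simp: crossover_def intro: order_trans)
qed (use assms in \<open>auto simp: crossover_def\<close>)

text \<open>The pairs (P, R) that extend to a balanced quadruple with a single common vertex.\<close>
definition crossing_pairs :: "nat \<Rightarrow> nat \<Rightarrow> (nat set \<times> nat set) set" where
  "crossing_pairs d k = {(P, R). P \<subseteq> {..<d} \<and> R \<subseteq> {..<d} \<and> card P = Suc k \<and> card R = Suc k \<and>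
     (\<exists>v. P \<inter> R = {v} \<and> card (P \<inter> {..<v}) = card (R \<inter> {..<v}))}"

lemma crossing_pair_balanced:
  assumes sub: "P \<subseteq> {..<d}" "R \<subseteq> {..<d}" and card: "card P = Suc k" "card R = Suc k"
    and v: "P \<inter> R = {v}" and rank: "card (P \<inter> {..<v}) = card (R \<inter> {..<v})"
  shows "(P, crossover v P R, R, crossover v R P) \<in> balanced_quads d k"
proof -
  have fin: "finite P" "finite R" using sub finite_subset by blast+
  have vin: "v \<in> P" "v \<in> R" using v by auto
  have "card (crossover v P R) = Suc k" "card (crossover v R P) = Suc k"
    using card_crossover[OF fin vin] card_crossover[OF fin(2,1) vin(2,1)] rank card
      card_split_at(1)[OF fin(1) vin(1)] card_split_at(1)[OF fin(2) vin(2)] by linarith+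
  moreover have "crossover v P R \<subseteq> {..<d}" "crossover v R P \<subseteq> {..<d}"
    using sub by (auto simp: crossover_def)
  ultimately show ?thesis
    using sub card fin vin step_mult_crossover[OF v]
    by (simp add: balanced_quads_def quads_def Min_crossover Max_crossover)
qed

text \<open>Such a quadruple is determined by (P, R), because Q and S are the two crossovers.\<close>
lemma card_single_crossing_quads:
  "card {(P, Q, R, S) \<in> balanced_quads d k. card (P \<inter> R) = 1} = card (crossing_pairs d k)"
proof (rule bij_betw_same_card)
  let ?B = "{(P, Q, R, S) \<in> balanced_quads d k. card (P \<inter> R) = 1}"
  let ?f = "\<lambda>(P, Q, R, S). (P, R)"
  show "bij_betw ?f ?B (crossing_pairs d k)"
    unfolding bij_betw_def
  proof
    show "inj_on ?f ?B"
    proof (rule inj_onI, clarsimp)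
      fix P Q R S Q' S'
      assume a: "(P, Q, R, S) \<in> balanced_quads d k" "(P, Q', R, S') \<in> balanced_quads d k" "card (P \<inter> R) = Suc 0"
      then obtain v where "P \<inter> R = {v}" by (metis card_1_singletonE One_nat_def)
      then show "Q = Q' \<and> S = S'"
        using balanced_single_crossing[OF a(1)] balanced_single_crossing[OF a(2)] by metis
    qed
    show "?f ` ?B = crossing_pairs d k"
    proof (intro equalityI subsetI)
      fix x assume "x \<in> ?f ` ?B"
      then obtain P Q R S where x: "x = (P, R)" and B: "(P, Q, R, S) \<in> balanced_quads d k" and c: "card (P \<inter> R) = 1"
        by auto
      obtain v where v: "P \<inter> R = {v}" using c by (metis card_1_singletonE)
      have "(P, Q, R, S) \<in> quads d k" using B by (simp add: balanced_quads_def)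
      with v balanced_single_crossing(3)[OF B v] show "x \<in> crossing_pairs d k"
        by (auto simp: x crossing_pairs_def quads_def)
    next
      fix x assume "x \<in> crossing_pairs d k"
      then obtain P R v where x: "x = (P, R)" "P \<subseteq> {..<d}" "R \<subseteq> {..<d}" "card P = Suc k" "card R = Suc k"
          "P \<inter> R = {v}" "card (P \<inter> {..<v}) = card (R \<inter> {..<v})"
        by (auto simp: crossing_pairs_def)
      from crossing_pair_balanced[OF x(2-7)] x(1,6) show "x \<in> ?f ` ?B" by force
    qed
  qed
qed

section \<open>Counting balanced quadruples\<close>

definition disjoint_pairs :: "nat set \<Rightarrow> nat \<Rightarrow> (nat set \<times> nat set) set" where
  "disjoint_pairs A j = {(X, Y). X \<subseteq> A \<and> Y \<subseteq> A \<and> card X = j \<and> card Y = j \<and> X \<inter> Y = {}}"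

text \<open>The right-hand side counts unions first and halvings second; in this form the first factor
  can be summed over v by \<open>sum_choose_mult_choose\<close>.\<close>
lemma card_disjoint_pairs:
  assumes "finite A"
  shows "card (disjoint_pairs A j) = (card A choose (2 * j)) * ((2 * j) choose j)"
proof -
  have "disjoint_pairs A j = (SIGMA X:{X. X \<subseteq> A \<and> card X = j}. {Y. Y \<subseteq> A - X \<and> card Y = j})"
    by (auto simp: disjoint_pairs_def)
  also have "card \<dots> = (\<Sum>X\<in>{X. X \<subseteq> A \<and> card X = j}. card {Y. Y \<subseteq> A - X \<and> card Y = j})"
    using assms by (intro card_SigmaI) auto
  also have "\<dots> = (\<Sum>X\<in>{X. X \<subseteq> A \<and> card X = j}. (card A - j) choose j)"
  proof (rule sum.cong)
    fix X assume "X \<in> {X. X \<subseteq> A \<and> card X = j}"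
    then show "card {Y. Y \<subseteq> A - X \<and> card Y = j} = (card A - j) choose j"
      using assms by (subst n_subsets) (auto simp: card_Diff_subset finite_subset)
  qed simp
  also have "\<dots> = (card A choose j) * ((card A - j) choose j)"
    using assms by (simp add: n_subsets)
  also have "\<dots> = (card A choose (2 * j)) * ((2 * j) choose j)"
  proof (cases "2 * j \<le> card A")
    case True
    then show ?thesis using choose_mult[of j "2 * j" "card A"] by simp
  next
    case False
    then have "card A - j < j \<or> card A < j" by linarith
    then show ?thesis using False by (auto simp: binomial_eq_0)
  qed
  finally show ?thesis .
qed

text \<open>Removing the common vertex v splits the pair into two disjoint j-subsets below v and two
  disjoint (k-j)-subsets above v.\<close>
lemma card_crossing_pairs_at:
  assumes "v < d" "j \<le> k"
  shows "card {(P, R) \<in> crossing_pairs d k. P \<inter> R = {v} \<and> card (P \<inter> {..<v}) = j} =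
    card (disjoint_pairs {..<v} j) * card (disjoint_pairs {v<..<d} (k - j))"
proof -
  let ?C = "{(P, R) \<in> crossing_pairs d k. P \<inter> R = {v} \<and> card (P \<inter> {..<v}) = j}"
  let ?D = "disjoint_pairs {..<v} j \<times> disjoint_pairs {v<..<d} (k - j)"
  let ?f = "\<lambda>(P, R). ((P \<inter> {..<v}, R \<inter> {..<v}), (P \<inter> {v<..}, R \<inter> {v<..}))"
  let ?g = "\<lambda>((X, X'), (Y, Y')). (insert v (X \<union> Y), insert v (X' \<union> Y'))"
  have "bij_betw ?f ?C ?D"
  proof (rule bij_betw_byWitness[where f' = ?g])
    show "\<forall>a\<in>?C. ?g (?f a) = a" by (force simp: neq_iff)
    show "\<forall>b\<in>?D. ?f (?g b) = b" by (fastforce simp: disjoint_pairs_def)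
    show "?f ` ?C \<subseteq> ?D"
    proof (rule image_subsetI)
      fix x assume "x \<in> ?C"
      then obtain P R where x: "x = (P, R)" and cp: "(P, R) \<in> crossing_pairs d k"
        and v: "P \<inter> R = {v}" and j: "card (P \<inter> {..<v}) = j"
        by auto
      have sub: "P \<subseteq> {..<d}" "R \<subseteq> {..<d}" and card: "card P = Suc k" "card R = Suc k"
         and r: "card (P \<inter> {..<v}) = card (R \<inter> {..<v})"
        using cp v by (auto simp: crossing_pairs_def)
      have fin: "finite P" "finite R" using sub finite_subset by blast+
      have vin: "v \<in> P" "v \<in> R" using v by auto
      have dis: "P \<inter> {..<v} \<inter> (R \<inter> {..<v}) = {}" "P \<inter> {v<..} \<inter> (R \<inter> {v<..}) = {}" using v by auto
      have "(P \<inter> {..<v}, R \<inter> {..<v}) \<in> disjoint_pairs {..<v} j"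
        using r j dis by (simp add: disjoint_pairs_def)
      moreover have "card (P \<inter> {v<..}) = k - j" "card (R \<inter> {v<..}) = k - j"
        using card_split_at[OF fin(1) vin(1)] card_split_at[OF fin(2) vin(2)] card r j by linarith+
      then have "(P \<inter> {v<..}, R \<inter> {v<..}) \<in> disjoint_pairs {v<..<d} (k - j)"
        using dis sub by (auto simp: disjoint_pairs_def)
      ultimately show "?f x \<in> ?D" by (simp add: x)
    qed
    show "?g ` ?D \<subseteq> ?C"
    proof (rule image_subsetI)
      fix x assume "x \<in> ?D"
      then obtain X X' Y Y' where x: "x = ((X, X'), (Y, Y'))" 
        and sub: "X \<subseteq> {..<v}" "X' \<subseteq> {..<v}" "Y \<subseteq> {v<..<d}" "Y' \<subseteq> {v<..<d}"
        and c: "card X = j" "card X' = j" "card Y = k - j" "card Y' = k - j"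
        and dis: "X \<inter> X' = {}" "Y \<inter> Y' = {}"
        by (auto simp: disjoint_pairs_def)
      have fin: "finite X" "finite X'" "finite Y" "finite Y'" using sub finite_subset by blast+
      have "X \<inter> Y = {}" "X' \<inter> Y' = {}" "v \<notin> X \<union> Y" "v \<notin> X' \<union> Y'" using sub by force+
      then have "card (insert v (X \<union> Y)) = Suc k" "card (insert v (X' \<union> Y')) = Suc k"
        using fin c assms by (simp_all add: card_Un_disjoint)
      moreover have "insert v (X \<union> Y) \<inter> {..<v} = X" "insert v (X' \<union> Y') \<inter> {..<v} = X'"
        using sub by auto
      moreover have "insert v (X \<union> Y) \<inter> insert v (X' \<union> Y') = {v}" using sub dis by force
      moreover have "insert v (X \<union> Y) \<subseteq> {..<d}" "insert v (X' \<union> Y') \<subseteq> {..<d}" using sub assms by force+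
      ultimately show "?g x \<in> ?C" using c by (simp add: crossing_pairs_def x)
    qed
  qed
  then have "card ?C = card ?D" by (rule bij_betw_same_card)
  then show ?thesis by (simp add: card_cartesian_product)
qed

text \<open>The common vertex v has rank 2j in the union, which has 2k+1 elements. Summing over v gives
  every (2k+1)-set of vertices once for each j, with multiplicity
  (2j choose j) (2(k-j) choose k-j), and these multiplicities add up to 4^k.\<close>
lemma card_crossing_pairs: "card (crossing_pairs d k) = 4 ^ k * (d choose (2 * k + 1))"
proof -
  let ?C = "\<lambda>(v, j). {(P, R) \<in> crossing_pairs d k. P \<inter> R = {v} \<and> card (P \<inter> {..<v}) = j}"
  have finC: "finite (crossing_pairs d k)"
    by (rule finite_subset[of _ "Pow {..<d} \<times> Pow {..<d}"]) (auto simp: crossing_pairs_def)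
  have "crossing_pairs d k = (\<Union>x\<in>{..<d} \<times> {..k}. ?C x)"
  proof (intro equalityI subsetI)
    fix x assume "x \<in> crossing_pairs d k"
    then obtain P R v where x: "x = (P, R)" "P \<subseteq> {..<d}" "R \<subseteq> {..<d}" "card P = Suc k" "P \<inter> R = {v}"
        "x \<in> crossing_pairs d k"
      by (auto simp: crossing_pairs_def)
    have "v \<in> P" "finite P" "v < d" using x finite_subset by blast+
    then have "card (P \<inter> {..<v}) \<le> k" using card_split_at[of P v] x by linarith
    with x \<open>v < d\<close> show "x \<in> (\<Union>x\<in>{..<d} \<times> {..k}. ?C x)" by auto
  qed auto
  also have "card \<dots> = (\<Sum>x\<in>{..<d} \<times> {..k}. card (?C x))"
    by (rule card_UN_disjoint) (auto intro: finite_subset[OF _ finC])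
  also have "\<dots> = (\<Sum>(v, j)\<in>{..<d} \<times> {..k}. ((2 * j) choose j) * ((2 * (k - j)) choose (k - j)) *
     ((v choose (2 * j)) * ((d - 1 - v) choose (2 * (k - j)))))"
    by (rule sum.cong) (auto simp: card_crossing_pairs_at card_disjoint_pairs)
  also have "\<dots> = (\<Sum>j\<le>k. \<Sum>v<d. ((2 * j) choose j) * ((2 * (k - j)) choose (k - j)) *
     ((v choose (2 * j)) * ((d - 1 - v) choose (2 * (k - j)))))"
    by (subst sum.swap) (simp add: sum.cartesian_product)
  also have "\<dots> = (\<Sum>j\<le>k. ((2 * j) choose j) * ((2 * (k - j)) choose (k - j)) * (d choose (2 * k + 1)))"
  proof (rule sum.cong)
    fix j assume "j \<in> {..k}"
    then have "2 * j + 2 * (k - j) + 1 = 2 * k + 1" by simp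
    then show "(\<Sum>v<d. ((2 * j) choose j) * ((2 * (k - j)) choose (k - j)) *
         ((v choose (2 * j)) * ((d - 1 - v) choose (2 * (k - j))))) =
       ((2 * j) choose j) * ((2 * (k - j)) choose (k - j)) * (d choose (2 * k + 1))"
      using sum_choose_mult_choose[of "2 * j" d "2 * (k - j)"] by (simp flip: sum_distrib_left)
  qed simp
  also have "\<dots> = 4 ^ k * (d choose (2 * k + 1))"
    unfolding sum_distrib_right[symmetric] sum_central_binomials ..
  finally show ?thesis .
qed

lemma card_small_subsets:
  assumes "d \<ge> 1" shows "card {U. U \<subseteq> {..<d} \<and> card U \<le> n} \<le> Suc n * d ^ n"
proof -
  have "{U. U \<subseteq> {..<d} \<and> card U \<le> n} = (\<Union>s\<le>n. {U. U \<subseteq> {..<d} \<and> card U = s})" by auto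
  also have "card \<dots> \<le> (\<Sum>s\<le>n. card {U. U \<subseteq> {..<d} \<and> card U = s})" by (rule card_UN_le) simp
  also have "\<dots> = (\<Sum>s\<le>n. d choose s)" by (simp add: n_subsets)
  also have "\<dots> \<le> (\<Sum>s\<le>n. d ^ n)"
  proof (rule sum_mono)
    fix s assume "s \<in> {..n}"
    show "d choose s \<le> d ^ n"
    proof (cases "s \<le> d")
      case True
      then have "d choose s \<le> d ^ s" by (rule binomial_le_pow)
      also have "\<dots> \<le> d ^ n" using \<open>s \<in> {..n}\<close> assms by (intro power_increasing) auto
      finally show ?thesis .
    qed (simp add: binomial_eq_0)
  qed
  also have "\<dots> = Suc n * d ^ n" by simp
  finally show ?thesis .
qed

text \<open>If P and R share at least two vertices, all four paths live on at most 2k vertices,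
  so these quadruples are too few by a factor of order d to contribute to the limit. The factor 2^(8k)
  bounds the number of ways to choose four subsets of a set with 2k elements.\<close>
lemma card_degenerate_quads:
  assumes "d \<ge> 1"
  shows "card {(P, Q, R, S) \<in> balanced_quads d k. card (P \<inter> R) \<noteq> 1} \<le> Suc (2 * k) * 2 ^ (8 * k) * d ^ (2 * k)"
proof -
  let ?B = "{(P, Q, R, S) \<in> balanced_quads d k. card (P \<inter> R) \<noteq> 1}"
  let ?U = "{U. U \<subseteq> {..<d} \<and> card U \<le> 2 * k}"
  have finU: "finite ?U" by simp
  have "?B \<subseteq> (\<Union>U\<in>?U. Pow U \<times> Pow U \<times> Pow U \<times> Pow U)"
  proof clarify
    fix P Q R S assume B: "(P, Q, R, S) \<in> balanced_quads d k" and c: "card (P \<inter> R) \<noteq> 1"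
    have q: "(P, Q, R, S) \<in> quads d k" using B by (simp add: balanced_quads_def)
    have fin: "finite P" "finite R" and card: "card P = Suc k" "card R = Suc k" and sub: "P \<union> R \<subseteq> {..<d}"
      using quadsD[OF q] by auto
    have "card (P \<inter> R) \<noteq> 0" using balanced_meet[OF B] fin by simp
    then have "card (P \<union> R) \<le> 2 * k" using card_Un_Int[OF fin] c card by linarith
    moreover have "Q \<subseteq> P \<union> R" "S \<subseteq> P \<union> R" using balanced_subset_union[OF B] by auto
    ultimately show "(P, Q, R, S) \<in> (\<Union>U\<in>?U. Pow U \<times> Pow U \<times> Pow U \<times> Pow U)"
      using sub by (intro UN_I[of "P \<union> R"]) auto
  qed
  then have "card ?B \<le> card (\<Union>U\<in>?U. Pow U \<times> Pow U \<times> Pow U \<times> Pow U)"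
  proof (intro card_mono finite_UN_I[OF finU])
    fix U assume "U \<in> ?U"
    then have "finite U" using finite_subset by blast
    then show "finite (Pow U \<times> Pow U \<times> Pow U \<times> Pow U)" by simp
  qed
  also have "\<dots> \<le> (\<Sum>U\<in>?U. card (Pow U \<times> Pow U \<times> Pow U \<times> Pow U))" by (rule card_UN_le[OF finU])
  also have "\<dots> \<le> (\<Sum>U\<in>?U. 2 ^ (8 * k))"
  proof (rule sum_mono)
    fix U assume U: "U \<in> ?U"
    then have "finite U" using finite_subset by blast
    then have "card (Pow U \<times> Pow U \<times> Pow U \<times> Pow U) = 2 ^ (4 * card U)"
      by (simp add: card_cartesian_product card_Pow flip: power_add)
    also have "\<dots> \<le> (2::nat) ^ (8 * k)" using U by (intro power_increasing) auto
    finally show "card (Pow U \<times> Pow U \<times> Pow U \<times> Pow U) \<le> 2 ^ (8 * k)" .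
  qed
  also have "\<dots> = card ?U * 2 ^ (8 * k)" by simp
  also have "\<dots> \<le> (Suc (2 * k) * d ^ (2 * k)) * 2 ^ (8 * k)"
    using card_small_subsets[OF assms] by (rule mult_right_mono) simp
  finally show ?thesis by (simp only: mult_ac)
qed

text \<open>The Gaussian moment E |t|^(2n) is n! times the n-th power of the variance; this is the
  product of the factorials that a balanced quadruple picks up.\<close>
definition step_weight :: "nat \<Rightarrow> nat set \<Rightarrow> nat set \<Rightarrow> real" where
  "step_weight d P R = (\<Prod>e\<in>{(i, j). i < j \<and> j < d}. fact (step_mult P R e))"

lemma finite_upper: "finite {(i, j :: nat). i < j \<and> j < d}"
  by (rule finite_subset[of _ "{..<d} \<times> {..<d}"]) auto

lemma step_weight_single_crossing: "P \<inter> R \<subseteq> {v} \<Longrightarrow> step_weight d P R = 1"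
  unfolding step_weight_def using step_mult_le_1[of P R v]
  by (intro prod.neutral) (metis le_Suc_eq le_zero_eq fact_0 fact_1 One_nat_def)

lemma step_weight_bounds:
  assumes "finite P" "P \<noteq> {}"
  shows "0 \<le> step_weight d P R" "step_weight d P R \<le> 2 ^ (card P - 1)"
proof -
  let ?U = "{(i, j). i < j \<and> j < d}"
  show "0 \<le> step_weight d P R" unfolding step_weight_def by (intro prod_nonneg) simp
  have "step_weight d P R \<le> (\<Prod>e\<in>?U. if e \<in> steps P then 2 else 1)"
    unfolding step_weight_def
    by (intro prod_mono) (auto simp: step_mult_def numeral_2_eq_2[symmetric])
  also have "\<dots> = 2 ^ card (?U \<inter> steps P)"
    using finite_upper by (simp add: prod.If_cases)
  also have "\<dots> \<le> 2 ^ (card P - 1)"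
  proof (rule power_increasing)
    have "card (?U \<inter> steps P) \<le> card (steps P)" using assms finite_steps by (intro card_mono) auto
    also have "\<dots> = card P - 1" using assms by (rule card_steps)
    finally show "card (?U \<inter> steps P) \<le> card P - 1" .
  qed simp
  finally show "step_weight d P R \<le> 2 ^ (card P - 1)" .
qed

text \<open>Quadruples with a single crossing have weight 1 and supply the limit; the degenerate ones have
  weight at most 2^k and number O(d^(2k)).\<close>
lemma balanced_weight_tendsto:
  "(\<lambda>d. (\<Sum>(P, Q, R, S)\<in>balanced_quads d k. step_weight d P R) / real d ^ (2 * k + 1)) \<longlonglongrightarrow> 4 ^ k / fact (2 * k + 1)"
proof -
  let ?w = "\<lambda>d (P, Q, R, S). step_weight d P R"
  define main where "main d = {(P, Q, R, S) \<in> balanced_quads d k. card (P \<inter> R) = 1}" for d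
  define rest where "rest d = {(P, Q, R, S) \<in> balanced_quads d k. card (P \<inter> R) \<noteq> 1}" for d
  have split: "(\<Sum>x\<in>balanced_quads d k. ?w d x) = (\<Sum>x\<in>main d. ?w d x) + (\<Sum>x\<in>rest d. ?w d x)" for d
  proof -
    have "balanced_quads d k = main d \<union> rest d" "main d \<inter> rest d = {}" by (auto simp: main_def rest_def)
    moreover have "finite (main d)" "finite (rest d)"
      by (rule finite_subset[OF _ finite_balanced_quads[of d k]]; auto simp: main_def rest_def)+
    ultimately show ?thesis by (simp add: sum.union_disjoint)
  qed
  have main: "(\<Sum>x\<in>main d. ?w d x) = 4 ^ k * real (d choose (2 * k + 1))" for d
  proof -
    have "(\<Sum>x\<in>main d. ?w d x) = (\<Sum>x\<in>main d. 1)"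
    proof (rule sum.cong)
      fix x assume "x \<in> main d"
      then obtain P Q R S where x: "x = (P, Q, R, S)" "card (P \<inter> R) = 1" by (auto simp: main_def)
      then obtain v where "P \<inter> R = {v}" by (metis card_1_singletonE)
      then show "?w d x = 1" using step_weight_single_crossing[of P R v] x by simp
    qed simp
    also have "\<dots> = real (card (main d))" by simp
    also have "card (main d) = 4 ^ k * (d choose (2 * k + 1))"
      unfolding main_def card_single_crossing_quads card_crossing_pairs ..
    finally show ?thesis by simp
  qed
  define C where "C = 2 ^ k * real (Suc (2 * k) * 2 ^ (8 * k))"
  have rest_bounds: "0 \<le> (\<Sum>x\<in>rest d. ?w d x) \<and> (\<Sum>x\<in>rest d. ?w d x) \<le> C * real d ^ (2 * k)" if "d \<ge> 1" for d
  proof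
    have w: "0 \<le> ?w d x" "?w d x \<le> 2 ^ k" if "x \<in> rest d" for x
    proof -
      from that obtain P Q R S where x: "x = (P, Q, R, S)" and q: "(P, Q, R, S) \<in> quads d k"
        by (auto simp: rest_def balanced_quads_def)
      show "0 \<le> ?w d x" "?w d x \<le> 2 ^ k"
        using step_weight_bounds[of P d R] quadsD(1,3,4)[OF q, of P] by (simp_all add: x)
    qed
    show "0 \<le> (\<Sum>x\<in>rest d. ?w d x)" by (rule sum_nonneg) (rule w)
    have "(\<Sum>x\<in>rest d. ?w d x) \<le> (\<Sum>x\<in>rest d. 2 ^ k)" by (rule sum_mono) (rule w)
    also have "\<dots> = 2 ^ k * real (card (rest d))" by simp
    also have "\<dots> \<le> 2 ^ k * real (Suc (2 * k) * 2 ^ (8 * k) * d ^ (2 * k))"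
      unfolding rest_def using card_degenerate_quads[OF that, of k] by (intro mult_left_mono of_nat_mono) auto
    also have "\<dots> = C * real d ^ (2 * k)" unfolding C_def of_nat_mult of_nat_power by (simp only: mult.assoc)
    finally show "(\<Sum>x\<in>rest d. ?w d x) \<le> C * real d ^ (2 * k)" .
  qed
  have "(\<lambda>d. (\<Sum>x\<in>rest d. ?w d x) / real d ^ (2 * k + 1)) \<longlonglongrightarrow> 0"
  proof (rule tendsto_sandwich[OF _ _ tendsto_const])
    show "(\<lambda>d. C / real d) \<longlonglongrightarrow> 0" by real_asymp
    show "\<forall>\<^sub>F d in sequentially. 0 \<le> (\<Sum>x\<in>rest d. ?w d x) / real d ^ (2 * k + 1)"
      using eventually_ge_at_top[of 1] by eventually_elim (use rest_bounds in auto)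
    show "\<forall>\<^sub>F d in sequentially. (\<Sum>x\<in>rest d. ?w d x) / real d ^ (2 * k + 1) \<le> C / real d"
      using eventually_ge_at_top[of 1]
    proof eventually_elim
      case (elim d)
      then have "(\<Sum>x\<in>rest d. ?w d x) / real d ^ (2 * k + 1) \<le> C * real d ^ (2 * k) / real d ^ (2 * k + 1)"
        using rest_bounds by (intro divide_right_mono) auto
      also have "\<dots> = C / real d" using elim by (simp add: field_simps)
      finally show ?case .
    qed
  qed
  moreover have "(\<lambda>d. 4 ^ k * (real (d choose (2 * k + 1)) / real d ^ (2 * k + 1))) \<longlonglongrightarrow> 4 ^ k * (1 / fact (2 * k + 1))"
    by (intro tendsto_mult tendsto_const binomial_over_power_tendsto)
  ultimately have "(\<lambda>d. 4 ^ k * (real (d choose (2 * k + 1)) / real d ^ (2 * k + 1)) +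
      (\<Sum>x\<in>rest d. ?w d x) / real d ^ (2 * k + 1)) \<longlonglongrightarrow> 4 ^ k * (1 / fact (2 * k + 1)) + 0"
    by (intro tendsto_add)
  then show ?thesis unfolding split main by (simp add: add_divide_distrib)
qed

section \<open>Moments of complex Gaussian variables\<close>

definition normal_moment :: "real \<Rightarrow> nat \<Rightarrow> real" where
  "normal_moment s p = (\<integral>x. normal_density 0 s x * x ^ p \<partial>lborel)"

lemma normal_moment_values:
  assumes "s > 0"
  shows "normal_moment s 0 = 1" "normal_moment s (Suc 0) = 0" "normal_moment s 2 = s\<^sup>2" "normal_moment s 3 = 0" "normal_moment s 4 = 3 * s ^ 4"
  using integral_normal_moment_even[OF assms, of 0 0] integral_normal_moment_even[OF assms, of 0 1]
    integral_normal_moment_even[OF assms, of 0 2]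
    integral_normal_moment_odd[OF assms, of 0 0] integral_normal_moment_odd[OF assms, of 0 1]
  by (simp_all add: normal_moment_def fact_numeral field_simps eval_nat_numeral)

abbreviation normal_measure :: "real \<Rightarrow> real measure" where
  "normal_measure s \<equiv> density lborel (\<lambda>x. ennreal (normal_density 0 s x))"

lemma integrable_pow_normal:
  assumes "s > 0"
  shows "integrable (normal_measure s) (\<lambda>x. complex_of_real (x ^ p))"
    and "(\<integral>x. complex_of_real (x ^ p) \<partial>normal_measure s) = complex_of_real (normal_moment s p)"
proof -
  have "integrable (normal_measure s) (\<lambda>x. x ^ p)"
    using integrable_normal_moment[OF assms, of 0 p] by (subst integrable_density) auto
  then show "integrable (normal_measure s) (\<lambda>x. complex_of_real (x ^ p))"
    by (rule integrable_of_real)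
  have "(\<integral>x. x ^ p \<partial>normal_measure s) = normal_moment s p"
    unfolding normal_moment_def by (subst integral_density) auto
  then show "(\<integral>x. complex_of_real (x ^ p) \<partial>normal_measure s) = complex_of_real (normal_moment s p)"
    by (simp only: integral_complex_of_real)
qed

lemma (in pair_sigma_finite) has_bochner_integral_mult_pair:
  fixes f :: "'a \<Rightarrow> 'c::{real_normed_field, banach, second_countable_topology}"
  assumes f: "integrable M1 f" and g: "integrable M2 g"
  shows "has_bochner_integral (M1 \<Otimes>\<^sub>M M2) (\<lambda>z. f (fst z) * g (snd z)) (integral\<^sup>L M1 f * integral\<^sup>L M2 g)"
proof -
  have [measurable]: "f \<in> borel_measurable M1" "g \<in> borel_measurable M2" using f g by auto
  have int: "integrable (M1 \<Otimes>\<^sub>M M2) (\<lambda>z. f (fst z) * g (snd z))"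
  proof (rule Fubini_integrable)
    show "integrable M1 (\<lambda>x. \<integral>y. norm (f (fst (x, y)) * g (snd (x, y))) \<partial>M2)"
      using f g by (simp add: norm_mult)
    show "AE x in M1. integrable M2 (\<lambda>y. f (fst (x, y)) * g (snd (x, y)))"
      using g by simp
  qed simp
  moreover have "integral\<^sup>L (M1 \<Otimes>\<^sub>M M2) (\<lambda>z. f (fst z) * g (snd z)) = integral\<^sup>L M1 f * integral\<^sup>L M2 g"
    using integral_fst'[OF int] by simp
  ultimately show ?thesis by (simp add: has_bochner_integral_iff)
qed

text \<open>Binomial expansion of t = x + iy and of its conjugate, with independent x and y.\<close>
lemma complex_gaussian_moment_sum:
  assumes "v > 0"
  defines "\<mu> \<equiv> normal_moment (sqrt (v / 2))"
  shows "has_bochner_integral (complex_gaussian v) (\<lambda>t. t ^ n * cnj t ^ m)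
    (\<Sum>a\<le>n. \<Sum>b\<le>m. of_nat (n choose a) * of_nat (m choose b) * \<i> ^ (n - a) * (- \<i>) ^ (m - b) *
        complex_of_real (\<mu> (a + b) * \<mu> ((n - a) + (m - b))))"
proof -
  let ?N = "normal_measure (sqrt (v / 2))"
  have s: "sqrt (v / 2) > 0" using assms by simp
  interpret N: prob_space ?N using s by (rule prob_space_normal_density)
  interpret pair_sigma_finite ?N ?N ..
  have eq: "Complex x y ^ n * cnj (Complex x y) ^ m =
     (\<Sum>a\<le>n. \<Sum>b\<le>m. of_nat (n choose a) * of_nat (m choose b) * \<i> ^ (n - a) * (- \<i>) ^ (m - b) *
        (complex_of_real (x ^ (a + b)) * complex_of_real (y ^ ((n - a) + (m - b)))))" for x y
  proof -
    have z: "Complex x y = of_real x + \<i> * of_real y" "cnj (Complex x y) = of_real x + (- \<i>) * of_real y"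
      by (simp_all add: complex_eq_iff)
    show ?thesis
      unfolding z(2) unfolding z(1) binomial_ring
      by (simp only: sum_product power_mult_distrib power_add of_real_mult of_real_power mult_ac)
  qed
  have "has_bochner_integral (?N \<Otimes>\<^sub>M ?N) (\<lambda>z. Complex (fst z) (snd z) ^ n * cnj (Complex (fst z) (snd z)) ^ m)
    (\<Sum>a\<le>n. \<Sum>b\<le>m. of_nat (n choose a) * of_nat (m choose b) * \<i> ^ (n - a) * (- \<i>) ^ (m - b) *
        complex_of_real (\<mu> (a + b) * \<mu> ((n - a) + (m - b))))"
    unfolding eq
  proof (intro has_bochner_integral_sum has_bochner_integral_mult_right)
    fix a b
    show "has_bochner_integral (?N \<Otimes>\<^sub>M ?N)
        (\<lambda>z. complex_of_real (fst z ^ (a + b)) * complex_of_real (snd z ^ ((n - a) + (m - b))))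
        (complex_of_real (\<mu> (a + b) * \<mu> ((n - a) + (m - b))))"
      using has_bochner_integral_mult_pair[OF integrable_pow_normal(1)[OF s] integrable_pow_normal(1)[OF s], of "a + b" "(n - a) + (m - b)"]
      unfolding integrable_pow_normal(2)[OF s] \<mu>_def by simp
  qed
  moreover have [measurable]: "(\<lambda>z. Complex (fst z) (snd z)) \<in> borel_measurable (?N \<Otimes>\<^sub>M ?N)"
    unfolding Complex_eq by measurable
  moreover have "(\<lambda>t. t ^ n * cnj t ^ m) \<in> borel_measurable borel"
    by (intro borel_measurable_continuous_onI continuous_intros)
  ultimately show ?thesis
    unfolding complex_gaussian_def Let_def case_prod_beta'
    by (subst has_bochner_integral_distr) auto
qed

text \<open>Exponents up to 2 suffice below, since two increasing paths traverse a given step at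
  most twice in total; for these the sum over products of real normal moments is evaluated directly.\<close>
lemma complex_gaussian_moments:
  assumes "v > 0" and "n \<le> 2" "m \<le> 2"
  shows "integrable (complex_gaussian v) (\<lambda>t. t ^ n * cnj t ^ m)"
    and "(\<integral>t. t ^ n * cnj t ^ m \<partial>complex_gaussian v) = (if n = m then fact n * of_real v ^ n else 0)"
proof -
  note H = complex_gaussian_moment_sum[OF assms(1), of n m]
  show "integrable (complex_gaussian v) (\<lambda>t. t ^ n * cnj t ^ m)"
    using H by (auto simp: has_bochner_integral_iff)
  have s: "sqrt (v / 2) > 0" using assms by simp
  have s2: "sqrt (v / 2) ^ 2 = v / 2" using assms(1) by simp
  have "sqrt (v / 2) ^ 4 = (sqrt (v / 2) ^ 2) ^ 2" by (simp flip: power_mult)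
  then have s4: "sqrt (v / 2) ^ 4 = v * v / 4" unfolding s2 by (simp add: power2_eq_square)
  define \<mu> where "\<mu> = normal_moment (sqrt (v / 2))"
  have \<mu>: "\<mu> 0 = 1" "\<mu> (Suc 0) = 0" "\<mu> (Suc (Suc 0)) = v / 2" "\<mu> (Suc (Suc (Suc 0))) = 0"
    "\<mu> (Suc (Suc (Suc (Suc 0)))) = 3 * (v * v) / 4"
    using normal_moment_values[OF s] unfolding s2 s4 \<mu>_def[symmetric] by (simp_all add: numeral_eq_Suc)
  have "n \<in> {0, 1, 2}" "m \<in> {0, 1, 2}" using assms by auto
  then show "(\<integral>t. t ^ n * cnj t ^ m \<partial>complex_gaussian v) = (if n = m then fact n * of_real v ^ n else 0)"
    unfolding has_bochner_integral_integral_eq[OF H] \<mu>_def[symmetric]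
    by (auto simp: atMost_Suc numeral_eq_Suc \<mu> algebra_simps)
qed

lemma prob_space_complex_gaussian: "v > 0 \<Longrightarrow> prob_space (complex_gaussian v)"
proof -
  assume v: "v > 0"
  let ?N = "normal_measure (sqrt (v / 2))"
  have s: "sqrt (v / 2) > 0" using v by simp
  interpret N: prob_space ?N using s by (rule prob_space_normal_density)
  interpret pair_prob_space ?N ?N ..
  have [measurable]: "(\<lambda>z. Complex (fst z) (snd z)) \<in> borel_measurable (?N \<Otimes>\<^sub>M ?N)"
    unfolding Complex_eq by measurable
  show ?thesis
    unfolding complex_gaussian_def Let_def case_prod_beta' by (rule prob_space_distr) simp
qed

lemma integral_upper_entries_monomial:
  assumes d: "d > 0" and le: "\<And>e. n e \<le> 2" "\<And>e. m e \<le> 2"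
  defines "U \<equiv> {(i, j). i < j \<and> j < d}"
  shows "integrable (upper_entries d) (\<lambda>\<omega>. \<Prod>e\<in>U. \<omega> e ^ n e * cnj (\<omega> e) ^ m e)"
    and "(\<integral>\<omega>. (\<Prod>e\<in>U. \<omega> e ^ n e * cnj (\<omega> e) ^ m e) \<partial>upper_entries d) =
      (if \<forall>e\<in>U. n e = m e then (\<Prod>e\<in>U. fact (n e)) / of_nat d ^ (\<Sum>e\<in>U. n e) else 0)"
proof -
  have v: "1 / real d > 0" using d by simp
  interpret prob_space "complex_gaussian (1 / real d)" using v by (rule prob_space_complex_gaussian)
  interpret product_sigma_finite "\<lambda>_ :: nat \<times> nat. complex_gaussian (1 / real d)" ..
  have fin: "finite U" by (rule finite_subset[of _ "{..<d} \<times> {..<d}"]) (auto simp: U_def)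
  note I = complex_gaussian_moments[OF v le]
  show "integrable (upper_entries d) (\<lambda>\<omega>. \<Prod>e\<in>U. \<omega> e ^ n e * cnj (\<omega> e) ^ m e)"
    unfolding upper_entries_def U_def[symmetric]
    by (rule product_integrable_prod[OF fin I(1)])
  have "(\<integral>\<omega>. (\<Prod>e\<in>U. \<omega> e ^ n e * cnj (\<omega> e) ^ m e) \<partial>upper_entries d) =
     (\<Prod>e\<in>U. if n e = m e then fact (n e) * of_real (1 / real d) ^ n e else 0)"
    unfolding upper_entries_def U_def[symmetric]
    by (subst product_integral_prod[OF fin I(1)]) (simp add: I(2))
  also have "\<dots> = (if \<forall>e\<in>U. n e = m e then (\<Prod>e\<in>U. fact (n e)) / of_nat d ^ (\<Sum>e\<in>U. n e) else 0)"
    using fin by (auto simp: prod.distrib power_sum prod_dividef power_divide prod_zero)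
  finally show "(\<integral>\<omega>. (\<Prod>e\<in>U. \<omega> e ^ n e * cnj (\<omega> e) ^ m e) \<partial>upper_entries d) =
      (if \<forall>e\<in>U. n e = m e then (\<Prod>e\<in>U. fact (n e)) / of_nat d ^ (\<Sum>e\<in>U. n e) else 0)" .
qed

section \<open>Powers of a strictly upper triangular matrix\<close>

definition path_weight :: "(nat \<times> nat \<Rightarrow> complex) \<Rightarrow> nat set \<Rightarrow> complex" where
  "path_weight \<omega> S = (\<Prod>e\<in>steps S. \<omega> e)"

definition paths :: "nat \<Rightarrow> nat \<Rightarrow> nat \<Rightarrow> nat \<Rightarrow> nat set set" where
  "paths d k i j = {S. S \<subseteq> {..<d} \<and> card S = Suc k \<and> Min S = i \<and> Max S = j}"

lemma finite_paths: "finite (paths d k i j)"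
  by (rule finite_subset[of _ "Pow {..<d}"]) (auto simp: paths_def)

lemma pathsD:
  assumes "S \<in> paths d k i j"
  shows "finite S" "S \<noteq> {}" "S \<subseteq> {..<d}" "card S = Suc k" "Min S = i" "Max S = j" "i \<in> S"
proof -
  show "S \<subseteq> {..<d}" "card S = Suc k" "Min S = i" "Max S = j" using assms by (auto simp: paths_def)
  then show fin: "finite S" "S \<noteq> {}" using card.infinite by fastforce+
  show "i \<in> S" using Min_in[OF fin] \<open>Min S = i\<close> by simp
qed

lemma steps_insert_below:
  assumes "finite S" "S \<noteq> {}" "i < Min S"
  shows "steps (insert i S) = insert (i, Min S) (steps S)"
proof -
  have M: "Min S \<in> S" "\<And>x. x \<in> S \<Longrightarrow> Min S \<le> x" using assms by auto
  then have lt: "\<And>x. x \<in> S \<Longrightarrow> i < x" using assms(3) by force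
  show ?thesis
  proof (intro equalityI subsetI)
    fix e assume e: "e \<in> steps (insert i S)"
    obtain a b where ab: "e = (a, b)" by fastforce
    show "e \<in> insert (i, Min S) (steps S)"
    proof (cases "a = i")
      case True
      then have "b \<in> S" "\<not> (Min S < b)" using e ab lt M(1) by (auto simp: steps_def)
      then have "b = Min S" using M(2)[of b] by simp
      then show ?thesis using ab True by simp
    next
      case False
      then show ?thesis using e lt ab by (fastforce simp: steps_def)
    qed
  next
    fix e assume "e \<in> insert (i, Min S) (steps S)"
    then show "e \<in> steps (insert i S)" 
    proof
      assume "e = (i, Min S)"
      moreover have "insert i S \<inter> {i<..<Min S} = {}" using M(2) by force
      ultimately show ?thesis using M(1) assms(3) by (simp add: steps_def)
    next
      assume "e \<in> steps S"
      then show ?thesis using lt by (fastforce simp: steps_def)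
    qed
  qed
qed

text \<open>A path is its first vertex followed by a path that starts at a later vertex. This mirrors the
  recursion for matrix powers.\<close>
lemma paths_Suc:
  assumes "i < d"
  shows "paths d (Suc k) i j = (\<Union>l\<in>{i<..<d}. insert i ` paths d k l j)"
proof (intro equalityI subsetI)
  fix S assume S: "S \<in> paths d (Suc k) i j"
  note D = pathsD[OF S]
  let ?S = "S - {i}"
  have c: "card ?S = Suc k" using D by simp
  have ne: "?S \<noteq> {}" "finite ?S" using c D(1) by force+
  have "i < x" if "x \<in> ?S" for x using that D(5) Min_le[OF D(1), of x] by auto
  then have "i < Min ?S" using ne by simp
  moreover have "Min ?S < d" using Min_in[OF ne(2,1)] D(3) by auto
  moreover have "Max ?S = j"
  proof -
    have "Max (insert i ?S) = max i (Max ?S)" using ne(2,1) by (rule Max_insert)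
    moreover have "insert i ?S = S" using D(7) by auto
    moreover have "i < Max ?S" using \<open>i < Min ?S\<close> ne by (meson Max_in Min_le order_less_le_trans)
    ultimately show ?thesis using D(6) by simp
  qed
  ultimately have "?S \<in> paths d k (Min ?S) j" "Min ?S \<in> {i<..<d}"
    using c D(3) by (auto simp: paths_def)
  moreover have "S = insert i ?S" using D(7) by auto
  ultimately show "S \<in> (\<Union>l\<in>{i<..<d}. insert i ` paths d k l j)" by blast
next
  fix S assume "S \<in> (\<Union>l\<in>{i<..<d}. insert i ` paths d k l j)"
  then obtain l R where l: "i < l" "l < d" and R: "R \<in> paths d k l j" and S: "S = insert i R" by auto
  note D = pathsD[OF R]
  have "l \<le> j" using D(5-7) Max_ge[OF D(1), of l] by simp
  have "i \<notin> R" using Min_le[OF D(1), of i] D(5) l by auto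
  then show "S \<in> paths d (Suc k) i j"
    using D l S assms \<open>l \<le> j\<close> by (simp add: paths_def)
qed

lemma upper_mat_carrier: "upper_mat d \<omega> \<in> carrier_mat d d"
  by (simp add: upper_mat_def)

lemma mat_adjoint_dim: "A \<in> carrier_mat d d \<Longrightarrow> mat_adjoint A \<in> carrier_mat d d"
  by (auto simp: mat_adjoint_def mat_of_rows_def)

lemma mat_adjoint_index:
  fixes A :: "complex mat"
  assumes "A \<in> carrier_mat d d" "i < d" "j < d"
  shows "mat_adjoint A $$ (i, j) = cnj (A $$ (j, i))"
  using assms by (simp add: mat_adjoint_def mat_of_rows_def)

lemma mat_adjoint_mult:
  fixes A B :: "complex mat"
  assumes "A \<in> carrier_mat d d" "B \<in> carrier_mat d d"
  shows "mat_adjoint (A * B) = mat_adjoint B * mat_adjoint A"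
proof (rule eq_matI)
  fix i j assume "i < dim_row (mat_adjoint B * mat_adjoint A)" "j < dim_col (mat_adjoint B * mat_adjoint A)"
  then have ij: "i < d" "j < d" using mat_adjoint_dim assms by auto
  have "mat_adjoint (A * B) $$ (i, j) = cnj ((A * B) $$ (j, i))"
    using assms ij by (intro mat_adjoint_index) auto
  also have "\<dots> = (\<Sum>l<d. cnj (A $$ (j, l)) * cnj (B $$ (l, i)))"
    using assms ij by (simp add: scalar_prod_def atLeast0LessThan)
  also have "\<dots> = (mat_adjoint B * mat_adjoint A) $$ (i, j)"
    using assms ij mat_adjoint_dim[OF assms(1)] mat_adjoint_dim[OF assms(2)]
    by (simp add: scalar_prod_def atLeast0LessThan mat_adjoint_index mult.commute)
  finally show "mat_adjoint (A * B) $$ (i, j) = (mat_adjoint B * mat_adjoint A) $$ (i, j)" .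
qed (use assms mat_adjoint_dim[of A d] mat_adjoint_dim[of B d] mat_adjoint_dim[of "A * B" d] in auto)

lemma mat_word_carrier: "A \<in> carrier_mat d d \<Longrightarrow> mat_word d A w \<in> carrier_mat d d"
  by (induction w) (auto split: letter.split intro: mult_carrier_mat mat_adjoint_dim)

lemma mat_word_append:
  assumes "A \<in> carrier_mat d d"
  shows "mat_word d A (u @ w) = mat_word d A u * mat_word d A w"
proof (induction u)
  case Nil
  then show ?case using mat_word_carrier[OF assms, of w] by simp
next
  case (Cons l u)
  let ?L = "case l of Plain \<Rightarrow> A | Star \<Rightarrow> mat_adjoint A"
  have "?L \<in> carrier_mat d d" using assms mat_adjoint_dim by (auto split: letter.split)
  then show ?case
    using Cons mat_word_carrier[OF assms, of u] mat_word_carrier[OF assms, of w]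
    by (simp add: assoc_mult_mat[of _ d d _ d _ d])
qed

lemma mat_word_Star:
  assumes "A \<in> carrier_mat d d"
  shows "mat_word d A (replicate k Star) = mat_adjoint (mat_word d A (replicate k Plain))"
proof (induction k)
  case 0
  have "mat_adjoint (1\<^sub>m d :: complex mat) \<in> carrier_mat d d"
    by (rule mat_adjoint_dim[OF one_carrier_mat])
  note dim = carrier_matD[OF this]
  show ?case
  proof (rule eq_matI)
    fix i j assume "i < dim_row (mat_adjoint (mat_word d A (replicate 0 Plain)))"
      "j < dim_col (mat_adjoint (mat_word d A (replicate 0 Plain)))"
    then have "i < d" "j < d" using dim by auto
    then show "mat_word d A (replicate 0 Star) $$ (i, j) = mat_adjoint (mat_word d A (replicate 0 Plain)) $$ (i, j)"
      by (simp add: mat_adjoint_index[OF one_carrier_mat])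
  qed (use dim in auto)
next
  case (Suc k)
  have "mat_word d A (replicate (Suc k) Star) = mat_adjoint A * mat_adjoint (mat_word d A (replicate k Plain))"
    using Suc by simp
  also have "\<dots> = mat_adjoint (mat_word d A (replicate k Plain) * A)"
    using assms mat_word_carrier[OF assms] by (intro mat_adjoint_mult[symmetric])
  also have "mat_word d A (replicate k Plain) * A = mat_word d A (replicate k Plain @ [Plain])"
    using assms by (simp add: mat_word_append)
  also have "replicate k Plain @ [Plain] = replicate (Suc k) Plain"
    by (simp add: replicate_append_same)
  finally show ?case .
qed

text \<open>Only increasing chains of indices contribute to a product of strictly upper triangular
  matrices.\<close>
lemma upper_mat_power_index:
  assumes "i < d" "j < d"
  shows "mat_word d (upper_mat d \<omega>) (replicate k Plain) $$ (i, j) = (\<Sum>S\<in>paths d k i j. path_weight \<omega> S)"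
  using assms
proof (induction k arbitrary: i)
  case 0
  have "paths d 0 i j = (if i = j then {{i}} else {})"
    using 0 by (auto simp: paths_def card_Suc_eq)
  moreover have "steps {l} = {}" for l by (auto simp: steps_def)
  ultimately show ?case using 0 by (simp add: path_weight_def)
next
  case (Suc k)
  let ?A = "upper_mat d \<omega>"
  have C: "mat_word d ?A (replicate k Plain) \<in> carrier_mat d d" by (rule mat_word_carrier[OF upper_mat_carrier])
  have "mat_word d ?A (replicate (Suc k) Plain) $$ (i, j) =
      (\<Sum>l<d. ?A $$ (i, l) * mat_word d ?A (replicate k Plain) $$ (l, j))"
    using C upper_mat_carrier[of d \<omega>] Suc.prems by (simp add: scalar_prod_def atLeast0LessThan)
  also have "\<dots> = (\<Sum>l\<in>{i<..<d}. \<omega> (i, l) * (\<Sum>S\<in>paths d k l j. path_weight \<omega> S))"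
    using Suc by (intro sum.mono_neutral_cong_right) (auto simp: upper_mat_def)
  also have "\<dots> = (\<Sum>l\<in>{i<..<d}. \<Sum>S\<in>insert i ` paths d k l j. path_weight \<omega> S)"
  proof (rule sum.cong)
    fix l assume l: "l \<in> {i<..<d}"
    have notin: "i \<notin> S" if "S \<in> paths d k l j" for S
      using Min_le[OF pathsD(1)[OF that], of i] pathsD(5)[OF that] l by auto
    then have "inj_on (insert i) (paths d k l j)" by (auto intro!: inj_onI simp: insert_ident)
    then have "(\<Sum>S\<in>insert i ` paths d k l j. path_weight \<omega> S) = (\<Sum>S\<in>paths d k l j. path_weight \<omega> (insert i S))"
      by (simp add: sum.reindex)
    also have "\<dots> = (\<Sum>S\<in>paths d k l j. \<omega> (i, l) * path_weight \<omega> S)"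
    proof (rule sum.cong)
      fix S assume S: "S \<in> paths d k l j"
      have "steps (insert i S) = insert (i, l) (steps S)"
        using steps_insert_below[of S i] pathsD[OF S] l by simp
      moreover have "(i, l) \<notin> steps S" using notin[OF S] by (simp add: steps_def)
      ultimately show "path_weight \<omega> (insert i S) = \<omega> (i, l) * path_weight \<omega> S"
        using finite_steps[OF pathsD(1)[OF S]] by (simp add: path_weight_def)
    qed simp
    finally show "\<omega> (i, l) * (\<Sum>S\<in>paths d k l j. path_weight \<omega> S) = (\<Sum>S\<in>insert i ` paths d k l j. path_weight \<omega> S)"
      by (simp add: sum_distrib_left)
  qed simp
  also have "\<dots> = (\<Sum>S\<in>paths d (Suc k) i j. path_weight \<omega> S)"
    unfolding paths_Suc[OF Suc.prems(1)]
  proof (rule sum.UNION_disjoint[symmetric])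
    show "\<forall>l\<in>{i<..<d}. \<forall>l'\<in>{i<..<d}. l \<noteq> l' \<longrightarrow> insert i ` paths d k l j \<inter> insert i ` paths d k l' j = {}"
    proof (intro ballI impI equals0I)
      fix l l' S assume l: "l \<in> {i<..<d}" "l' \<in> {i<..<d}" "l \<noteq> l'"
        and "S \<in> insert i ` paths d k l j \<inter> insert i ` paths d k l' j"
      then obtain R R' where R: "R \<in> paths d k l j" "R' \<in> paths d k l' j" "insert i R = insert i R'" by auto
      have "i \<notin> R" "i \<notin> R'"
        using Min_le[OF pathsD(1)[OF R(1)], of i] pathsD(5)[OF R(1)]
          Min_le[OF pathsD(1)[OF R(2)], of i] pathsD(5)[OF R(2)] l by auto
      then have "R = R'" using R(3) by (simp add: insert_ident)
      then show False using pathsD(5)[OF R(1)] pathsD(5)[OF R(2)] l(3) by simp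
    qed
  qed (simp_all add: finite_paths)
  finally show ?case .
qed

text \<open>Matrix indices x, y, z, u of the cyclic product are recovered from a quadruple as end points
  of its paths, so the sum over indices and paths is a sum over quadruples grouped by end points.\<close>
lemma trace_word_expansion:
  defines "W \<equiv> \<lambda>k. replicate k Star @ replicate k Plain @ replicate k Star @ replicate k Plain"
  shows "mat_trace (mat_word d (upper_mat d \<omega>) (W k)) =
    (\<Sum>(P, Q, R, S)\<in>quads d k. cnj (path_weight \<omega> P) * path_weight \<omega> Q * cnj (path_weight \<omega> R) * path_weight \<omega> S)"
proof -
  let ?A = "upper_mat d \<omega>"
  define B where "B = mat_word d ?A (replicate k Plain)"
  define C where "C = mat_adjoint B"
  have BC: "B \<in> carrier_mat d d" "C \<in> carrier_mat d d"
    unfolding C_def B_def by (auto intro: mat_adjoint_dim mat_word_carrier upper_mat_carrier)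
  have "mat_word d ?A (W k) = C * (B * (C * B))"
    unfolding W_def B_def C_def mat_word_append[OF upper_mat_carrier] mat_word_Star[OF upper_mat_carrier] ..
  also have "mat_trace \<dots> = (\<Sum>x<d. \<Sum>y<d. \<Sum>z<d. \<Sum>u<d. C $$ (x, y) * (B $$ (y, z) * (C $$ (z, u) * B $$ (u, x))))"
    using BC by (simp add: mat_trace_def scalar_prod_def atLeast0LessThan sum_distrib_left)
  also have "\<dots> = (\<Sum>x<d. \<Sum>y<d. \<Sum>z<d. \<Sum>u<d. cnj (B $$ (y, x)) * (B $$ (y, z) * (cnj (B $$ (u, z)) * B $$ (u, x))))"
    unfolding C_def using BC(1) by (intro sum.cong refl) (simp add: mat_adjoint_index)
  also have "\<dots> = (\<Sum>(x, y, z, u)\<in>{..<d} \<times> {..<d} \<times> {..<d} \<times> {..<d}.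
      cnj (B $$ (y, x)) * (B $$ (y, z) * (cnj (B $$ (u, z)) * B $$ (u, x))))"
    by (simp add: sum.cartesian_product split_def)
  also have "\<dots> = (\<Sum>(x, y, z, u)\<in>{..<d} \<times> {..<d} \<times> {..<d} \<times> {..<d}.
      \<Sum>(P, Q, R, S)\<in>paths d k y x \<times> paths d k y z \<times> paths d k u z \<times> paths d k u x.
        cnj (path_weight \<omega> P) * path_weight \<omega> Q * cnj (path_weight \<omega> R) * path_weight \<omega> S)"
  proof (rule sum.cong, rule refl, clarify)
    fix x y z u assume *: "x < d" "y < d" "z < d" "u < d"
    show "cnj (B $$ (y, x)) * (B $$ (y, z) * (cnj (B $$ (u, z)) * B $$ (u, x))) =
      (\<Sum>(P, Q, R, S)\<in>paths d k y x \<times> paths d k y z \<times> paths d k u z \<times> paths d k u x.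
        cnj (path_weight \<omega> P) * path_weight \<omega> Q * cnj (path_weight \<omega> R) * path_weight \<omega> S)"
      unfolding B_def upper_mat_power_index[OF *(2,1)] upper_mat_power_index[OF *(2,3)]
        upper_mat_power_index[OF *(4,3)] upper_mat_power_index[OF *(4,1)] cnj_sum sum_product sum.cartesian_product
      by (simp add: sum.cartesian_product split_def mult.assoc)
  qed
  also have "\<dots> = (\<Sum>(P, Q, R, S)\<in>quads d k. cnj (path_weight \<omega> P) * path_weight \<omega> Q * cnj (path_weight \<omega> R) * path_weight \<omega> S)"
  proof -
    let ?h = "\<lambda>(P, Q, R, S). cnj (path_weight \<omega> P) * path_weight \<omega> Q * cnj (path_weight \<omega> R) * path_weight \<omega> S"
    let ?T = "{..<d} \<times> {..<d} \<times> {..<d} \<times> {..<d}"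
    let ?g = "\<lambda>(P, Q, R, S). (Max P, Min P, Max Q, Min S) :: nat \<times> nat \<times> nat \<times> nat"
    have "?g ` quads d k \<subseteq> ?T"
    proof (rule image_subsetI)
      fix q assume q: "q \<in> quads d k"
      obtain P Q R S where q': "q = (P, Q, R, S)" by (metis prod_cases4)
      note D = quadsD[OF q[unfolded q']]
      have "Max P \<in> P" "Min P \<in> P" "Max Q \<in> R" "Min S \<in> R" 
        using D(5,6,7,8) D(1)[of P] D(3)[of P] by auto
      then show "?g q \<in> ?T" using D(2)[of P] D(2)[of R] by (auto simp: q')
    qed
    then have "(\<Sum>q\<in>quads d k. ?h q) = (\<Sum>t\<in>?T. \<Sum>q\<in>{q \<in> quads d k. ?g q = t}. ?h q)"
      by (intro sum.group[symmetric] finite_quads) auto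
    also have "\<dots> = (\<Sum>(x, y, z, u)\<in>?T.
      \<Sum>q\<in>paths d k y x \<times> paths d k y z \<times> paths d k u z \<times> paths d k u x. ?h q)"
    proof (rule sum.cong, rule refl, clarify, rule sum.cong)
      fix x y z u
      show "{q \<in> quads d k. ?g q = (x, y, z, u)} =
          paths d k y x \<times> paths d k y z \<times> paths d k u z \<times> paths d k u x"
        by (auto simp: quads_def paths_def)
    qed simp
    finally show ?thesis by simp
  qed
  finally show ?thesis .
qed

section \<open>The moment of the random matrices and its limit\<close>

lemma path_weight_monomial:
  assumes "S \<subseteq> {..<d}"
  shows "path_weight \<omega> S = (\<Prod>e\<in>{(i, j). i < j \<and> j < d}. \<omega> e ^ of_bool (e \<in> steps S))"
  unfolding path_weight_def using steps_subset[OF assms] finite_upper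
  by (intro prod.mono_neutral_cong_left) auto

text \<open>The total degree is 2k in the entries and 2k in their conjugates, and each conjugate pair
  contributes the variance 1/d.\<close>
lemma expectation_quad:
  assumes d: "d > 0" and q: "(P, Q, R, S) \<in> quads d k"
  defines "f \<equiv> \<lambda>\<omega>. cnj (path_weight \<omega> P) * path_weight \<omega> Q * cnj (path_weight \<omega> R) * path_weight \<omega> S"
  shows "integrable (upper_entries d) f"
    and "integral\<^sup>L (upper_entries d) f = (if step_mult P R = step_mult Q S then of_real (step_weight d P R) / of_nat d ^ (2 * k) else 0)"
proof -
  let ?U = "{(i, j). i < j \<and> j < d}"
  note D = quadsD[OF q]
  have sub: "P \<subseteq> {..<d}" "Q \<subseteq> {..<d}" "R \<subseteq> {..<d}" "S \<subseteq> {..<d}" using D(2) by auto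
  have f: "f = (\<lambda>\<omega>. \<Prod>e\<in>?U. \<omega> e ^ step_mult Q S e * cnj (\<omega> e) ^ step_mult P R e)"
    unfolding f_def path_weight_monomial[OF sub(1)] path_weight_monomial[OF sub(2)]
      path_weight_monomial[OF sub(3)] path_weight_monomial[OF sub(4)] step_mult_def
      cnj_prod complex_cnj_power prod.distrib[symmetric] power_add
    by (intro ext prod.cong refl) (simp only: mult_ac)
  have le: "step_mult X Y e \<le> 2" for X Y e by (simp add: step_mult_def)
  note I = integral_upper_entries_monomial[OF d, of "step_mult Q S" "step_mult P R", OF le le]
  show "integrable (upper_entries d) f" unfolding f by (rule I(1))
  have "(\<forall>e\<in>?U. step_mult Q S e = step_mult P R e) \<longleftrightarrow> step_mult P R = step_mult Q S"
  proof
    assume *: "\<forall>e\<in>?U. step_mult Q S e = step_mult P R e"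
    have "step_mult P R e = step_mult Q S e" for e
    proof (cases "e \<in> ?U")
      case False
      then have "e \<notin> steps P" "e \<notin> steps Q" "e \<notin> steps R" "e \<notin> steps S" using sub steps_subset by blast+
      then show ?thesis by (simp add: step_mult_def)
    next
      case True
      from bspec[OF * this] show ?thesis by (rule sym)
    qed
    then show "step_mult P R = step_mult Q S" by blast
  qed auto
  moreover have "(\<Sum>e\<in>?U. step_mult Q S e) = 2 * k"
  proof -
    have "(\<Sum>e\<in>?U. of_bool (e \<in> steps X)) = k" if "X \<in> {Q, S}" for X
    proof -
      have X: "X \<subseteq> {..<d}" "finite X" "X \<noteq> {}" "card X = Suc k" using that D(1-4)[of X] by auto
      have "(\<Sum>e\<in>?U. of_bool (e \<in> steps X)) = (\<Sum>e\<in>steps X. 1 :: nat)"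
        using steps_subset[OF X(1)] finite_upper by (intro sum.mono_neutral_cong_right) auto
      then show ?thesis using card_steps[OF X(2,3)] X(4) by simp
    qed
    then show ?thesis by (simp add: step_mult_def sum.distrib)
  qed
  ultimately show "integral\<^sup>L (upper_entries d) f = (if step_mult P R = step_mult Q S then of_real (step_weight d P R) / of_nat d ^ (2 * k) else 0)"
    unfolding f I(2) step_weight_def by simp
qed

lemma matrix_moment_quads:
  assumes d: "d > 0"
  shows "matrix_moment d (replicate k Star @ replicate k Plain @ replicate k Star @ replicate k Plain) =
    of_real ((\<Sum>(P, Q, R, S)\<in>balanced_quads d k. step_weight d P R) / real d ^ (2 * k + 1))"
proof -
  let ?f = "\<lambda>(P, Q, R, S) \<omega>. cnj (path_weight \<omega> P) * path_weight \<omega> Q * cnj (path_weight \<omega> R) * path_weight \<omega> S"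
  let ?E = "\<lambda>(P, Q, R, S). if step_mult P R = step_mult Q S then complex_of_real (step_weight d P R) / of_nat d ^ (2 * k) else 0"
  have int: "integrable (upper_entries d) (?f q)" "integral\<^sup>L (upper_entries d) (?f q) = ?E q" if "q \<in> quads d k" for q
    using that expectation_quad[OF d] by (cases q; simp)+
  have "matrix_moment d (replicate k Star @ replicate k Plain @ replicate k Star @ replicate k Plain) =
      (LINT \<omega>|upper_entries d. 1 / of_nat d * (\<Sum>q\<in>quads d k. ?f q \<omega>))"
    unfolding matrix_moment_def trace_word_expansion by (simp add: split_def)
  also have "\<dots> = 1 / of_nat d * (\<Sum>q\<in>quads d k. ?E q)"
    using int by (simp add: integral_sum)
  also have "(\<Sum>q\<in>quads d k. ?E q) = (\<Sum>(P, Q, R, S)\<in>balanced_quads d k. complex_of_real (step_weight d P R) / of_nat d ^ (2 * k))"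
    by (rule sum.mono_neutral_cong_right[OF finite_quads]) (auto simp: balanced_quads_def split: if_splits)
  also have "\<dots> = of_real (\<Sum>(P, Q, R, S)\<in>balanced_quads d k. step_weight d P R) / of_nat d ^ (2 * k)"
    by (simp add: split_def sum_divide_distrib)
  finally show ?thesis by simp
qed

lemma op_word_append: "op_word T (u @ w) = op_word T u \<circ> op_word T w"
  by (induction u) (simp_all add: o_assoc)

lemma op_word_replicate:
  "op_word T (replicate k Plain) = T ^^ k" "op_word T (replicate k Star) = op_adjoint T ^^ k"
  by (induction k) simp_all

theorem mainTheorem4:
  fixes T :: "'h::complex_hilbert \<Rightarrow> 'h"
    and \<tau> :: "('h \<Rightarrow> 'h) \<Rightarrow> complex"
    and k :: nat
  assumes "DT_delta0_1 T \<tau>"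
    and "k \<ge> 1"
  shows "\<tau> (((op_adjoint T ^^ k) \<circ> (T ^^ k)) ^^ 2) = 2 ^ (2 * k) / fact (2 * k + 1)"
proof -
  let ?w = "replicate k Star @ replicate k Plain @ replicate k Star @ replicate k Plain"
  have "op_word T ?w = ((op_adjoint T ^^ k) \<circ> (T ^^ k)) ^^ 2"
    by (simp add: op_word_append op_word_replicate numeral_2_eq_2 o_assoc)
  then have "(\<lambda>d. matrix_moment d ?w) \<longlonglongrightarrow> \<tau> (((op_adjoint T ^^ k) \<circ> (T ^^ k)) ^^ 2)"
    using assms(1) unfolding DT_delta0_1_def by metis
  moreover have "(\<lambda>d. matrix_moment d ?w) \<longlonglongrightarrow> complex_of_real (4 ^ k / fact (2 * k + 1))"
  proof (rule Lim_transform_eventually[OF tendsto_of_real[OF balanced_weight_tendsto]])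
    show "\<forall>\<^sub>F d in sequentially. of_real ((\<Sum>(P, Q, R, S)\<in>balanced_quads d k. step_weight d P R) / real d ^ (2 * k + 1)) = matrix_moment d ?w"
      using eventually_gt_at_top[of 0] by eventually_elim (rule matrix_moment_quads[symmetric])
  qed
  ultimately have "\<tau> (((op_adjoint T ^^ k) \<circ> (T ^^ k)) ^^ 2) = complex_of_real (4 ^ k / fact (2 * k + 1))"
    by (rule LIMSEQ_unique)
  then show ?thesis by (simp add: power_mult)
qed

end
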